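(* Let $k\ge2$ be an integer, let $g_0$ be a $k$-monotone density on $(0,\infty)$ with distribution function $G_0$, let $X_1,X_2,\dots$ be i.i.d. with density $g_0$, and let $\tilde g_n$ be the least squares estimator over $\mathcal M_k\cap L_2(\lambda)$ based on $X_1,\dots,X_n$. Fix $c>0$ and suppose that $\int_0^\infty x^{-1/2}\,dG_0(x)<\infty$. Then $\|\tilde g_n-g_0\|_2\to0$ almost surely, and $$\sup_{x\ge c}|\tilde g_n(x)-g_0(x)|\to0\quad\text{almost surely as }n\to\infty.$$
   Context: For $k\ge2$, a function $g$ on $(0,\infty)$ is $k$-monotone if $(-1)^l g^{(l)}$ is nonnegative, nonincreasing and convex for $l=0,\dots,k-2$. $\mathcal M_k$ is the class of $k$-monotone functions on $(0,\infty)$; $\lambda$ is Lebesgue measure on $(0,\infty)$ and $\|\cdot\|_2$ the norm of $L_2(\lambda)$. The least squares estimator $\tilde g_n$ is the minimizer over $g\in\mathcal M_k\cap L_2(\lambda)$ of $Q_n(g)=\frac12\int_0^\infty g^2(x)\,dx-\frac1n\sum_{i=1}^n g(X_i)$ (no constraint that $g$ integrates to one is imposed). *)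

theory Defs
  imports "HOL-Probability.Probability"
begin

text \<open>
  A function on the half-line is represented by a total function of which only the values on
  \<open>{0<..}\<close> matter; as this set is open, so do only those values for the derivatives there.
  For \<open>k \<ge> 2\<close>, existence of the derivatives up to order \<open>k - 2\<close> is required explicitly
  because \<^const>\<open>deriv\<close> is total.
\<close>

definition k_monotone :: "nat \<Rightarrow> (real \<Rightarrow> real) set" where
  "k_monotone k = {g.
     (\<forall>l<k - 2. \<forall>x>0. (deriv ^^ l) g field_differentiable at x) \<and>
     (\<forall>l\<le>k - 2.
        (\<forall>x>0. 0 \<le> (- 1) ^ l * (deriv ^^ l) g x) \<and>
        antimono_on {0<..} (\<lambda>x. (- 1) ^ l * (deriv ^^ l) g x) \<and>
        convex_on {0<..} (\<lambda>x. (- 1) ^ l * (deriv ^^ l) g x))}"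

definition L2 :: "(real \<Rightarrow> real) set" where
  "L2 = {g. set_borel_measurable lborel {0<..} g \<and> set_integrable lborel {0<..} (\<lambda>x. (g x)\<^sup>2)}"

text \<open>Only meaningful on \<^const>\<open>L2\<close>: the Bochner integral of a non-integrable function is 0.\<close>

definition L2_norm :: "(real \<Rightarrow> real) \<Rightarrow> real" where
  "L2_norm g = sqrt (LINT x:{0<..}|lborel. (g x)\<^sup>2)"

definition density_on_pos :: "(real \<Rightarrow> real) \<Rightarrow> bool" where
  "density_on_pos g \<longleftrightarrow> (\<forall>x>0. 0 \<le> g x) \<and> set_integrable lborel {0<..} g \<and>
     (LINT x:{0<..}|lborel. g x) = 1"

definition distribution_function :: "(real \<Rightarrow> real) \<Rightarrow> real \<Rightarrow> real" where
  "distribution_function g x = (LINT t:{0<..x}|lborel. g t)"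

definition ls_criterion :: "nat \<Rightarrow> (nat \<Rightarrow> real) \<Rightarrow> (real \<Rightarrow> real) \<Rightarrow> real" where
  "ls_criterion n x g =
     1 / 2 * (LINT t:{0<..}|lborel. (g t)\<^sup>2) - 1 / real n * (\<Sum>i=1..n. g (x i))"

definition is_lse :: "nat \<Rightarrow> nat \<Rightarrow> (nat \<Rightarrow> real) \<Rightarrow> (real \<Rightarrow> real) \<Rightarrow> bool" where
  "is_lse k n x g \<longleftrightarrow> is_arg_min (ls_criterion n x) (\<lambda>h. h \<in> k_monotone k \<inter> L2) g"

end

theory Submission
  imports Defs
begin

text \<open>
  Write \<open>P n f\<close> for the mean of \<open>f\<close> over the first \<open>n\<close> observations and
  \<open>w x = x powr (- 1 / 2)\<close>. The square-integrable \<open>k\<close>-monotone functions form a convex cone. The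
  minimizer \<open>g\<close> of the quadratic criterion over this cone is therefore characterized by
  \<open>\<integral> g\<^sup>2 = P n g\<close> and \<open>P n h \<le> \<integral> g h\<close> for all \<open>h\<close> in the cone. The moment condition implies
  that \<open>g0\<close> lies in the cone, and the choice \<open>h = g0\<close> gives the basic inequality
  (\<open>lse_error_le\<close>)
  \<open>\<integral> (g - g0)\<^sup>2 \<le> (P n g - \<integral> g g0) + (\<integral> g0\<^sup>2 - P n g0)\<close>.

  The second bracket tends to 0 by the strong law of large numbers. The first one involves the
  estimator, so a law is needed that is uniform over a class of functions. A decreasing function in
  \<open>L\<^sub>2\<close> lies below its norm times \<open>w\<close>, and inserting this into \<open>\<integral> g\<^sup>2 = P n g\<close> bounds the norm
  of \<open>g\<close> by \<open>P n w\<close>, which converges because \<open>w\<close> has a finite mean. Hence all late estimators are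
  decreasing functions below one envelope \<open>K w\<close>. For this class
  \<open>empirical_mean_uniform_upper_bound\<close> bounds the excess of \<open>P n f\<close> over \<open>\<integral> f g0\<close>
  uniformly: near 0 the envelope has small mass, far out it is small, and in between monotonicity
  reduces everything to the frequencies of finitely many intervals.

  Convergence in square mean becomes uniform convergence on \<open>[c, \<infinity>)\<close> by monotonicity
  (\<open>uniform_close_if_L2_close\<close>): convexity makes \<open>g0\<close> Lipschitz away from 0, so that a
  difference of \<open>\<epsilon>\<close> at one point persists on one side of it over a length that does not depend on
  the point.

  As \<open>w\<close> has no second moment in general, the strong law is needed under a first moment alone;
  it is proved by Etemadi's method of truncation and lacunary subsequences.
\<close>

section \<open>A strong law of large numbers under a first moment\<close>

text \<open>
  This replaces the Borel--Cantelli argument: by monotone convergence the sum of the functions has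
  a finite integral, so it is finite almost everywhere and its terms vanish. It serves below both
  for squared deviations and for indicators of exceptional events.
\<close>

lemma AE_tendsto_0_if_suminf_nn_integral_finite:
  fixes f :: "nat \<Rightarrow> 'a \<Rightarrow> real"
  assumes [measurable]: "\<And>n. f n \<in> borel_measurable M"
    and nonneg: "\<And>n x. 0 \<le> f n x"
    and fin: "(\<Sum>n. \<integral>\<^sup>+x. ennreal (f n x) \<partial>M) < \<infinity>"
  shows "AE x in M. (\<lambda>n. f n x) \<longlonglongrightarrow> 0"
proof -
  have "(\<integral>\<^sup>+x. (\<Sum>n. ennreal (f n x)) \<partial>M) = (\<Sum>n. \<integral>\<^sup>+x. ennreal (f n x) \<partial>M)"
    by (rule nn_integral_suminf) simp
  with fin have "AE x in M. (\<Sum>n. ennreal (f n x)) \<noteq> \<infinity>"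
    by (intro nn_integral_PInf_AE) auto
  then show ?thesis
  proof eventually_elim
    case (elim x)
    then have "summable (\<lambda>n. f n x)"
      using nonneg by (intro summable_suminf_not_top) auto
    then show ?case by (rule summable_LIMSEQ_zero)
  qed
qed

lemma integral_square_sum_orthogonal:
  fixes W :: "'i \<Rightarrow> 'a \<Rightarrow> real"
  assumes "finite I"
    and int: "\<And>i j. i \<in> I \<Longrightarrow> j \<in> I \<Longrightarrow> integrable M (\<lambda>x. W i x * W j x)"
    and orth: "\<And>i j. i \<in> I \<Longrightarrow> j \<in> I \<Longrightarrow> i \<noteq> j \<Longrightarrow> (\<integral>x. W i x * W j x \<partial>M) = 0"
  shows "integrable M (\<lambda>x. (\<Sum>i\<in>I. W i x)\<^sup>2)"
    and "(\<integral>x. (\<Sum>i\<in>I. W i x)\<^sup>2 \<partial>M) = (\<Sum>i\<in>I. \<integral>x. (W i x)\<^sup>2 \<partial>M)"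
proof -
  have eq: "(\<lambda>x. (\<Sum>i\<in>I. W i x)\<^sup>2) = (\<lambda>x. \<Sum>i\<in>I. \<Sum>j\<in>I. W i x * W j x)"
    by (simp add: power2_eq_square sum_product)
  show "integrable M (\<lambda>x. (\<Sum>i\<in>I. W i x)\<^sup>2)"
    unfolding eq by (intro Bochner_Integration.integrable_sum int)
  have "(\<integral>x. (\<Sum>i\<in>I. W i x)\<^sup>2 \<partial>M) = (\<Sum>i\<in>I. \<Sum>j\<in>I. \<integral>x. W i x * W j x \<partial>M)"
    unfolding eq by (simp add: int Bochner_Integration.integral_sum Bochner_Integration.integrable_sum)
  also have "\<dots> = (\<Sum>i\<in>I. \<Sum>j\<in>I. if i = j then \<integral>x. (W i x)\<^sup>2 \<partial>M else 0)"
    by (intro sum.cong refl) (auto simp: orth power2_eq_square)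
  finally show "(\<integral>x. (\<Sum>i\<in>I. W i x)\<^sup>2 \<partial>M) = (\<Sum>i\<in>I. \<integral>x. (W i x)\<^sup>2 \<partial>M)"
    using \<open>finite I\<close> by simp
qed

text \<open>
  Averages of nonnegative terms along indices that grow by a factor of about \<open>a\<close> control all
  averages up to that factor, while the geometric growth makes the variances along these indices
  summable.
\<close>

definition lacunary :: "real \<Rightarrow> nat \<Rightarrow> nat" where
  "lacunary a n = nat \<lfloor>a ^ n\<rfloor>"

lemma lacunary_bounds:
  assumes "a > 1"
  shows "lacunary a n \<ge> 1" "real (lacunary a n) \<le> a ^ n" "a ^ n < real (lacunary a n) + 1"
proof -
  have "a ^ n \<ge> 1" using assms by simp
  then have *: "\<lfloor>a ^ n\<rfloor> \<ge> 1" by simp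
  then show "lacunary a n \<ge> 1" unfolding lacunary_def by linarith
  have "real (lacunary a n) = of_int \<lfloor>a ^ n\<rfloor>"
    using * by (simp add: lacunary_def)
  then show "real (lacunary a n) \<le> a ^ n" "a ^ n < real (lacunary a n) + 1"
    by linarith+
qed

lemma lacunary_at_top:
  assumes "a > 1"
  shows "filterlim (\<lambda>n. real (lacunary a n)) at_top sequentially"
proof (rule filterlim_at_top_mono)
  have "filterlim (\<lambda>n. a ^ n) at_infinity sequentially"
    using assms by (intro filterlim_realpow_sequentially_gt1) simp
  then have "filterlim (\<lambda>n. a ^ n) at_top sequentially"
    by (rule filterlim_at_infinity_imp_filterlim_at_top) (use assms in auto)
  then show "filterlim (\<lambda>n. - 1 + a ^ n) at_top sequentially"
    by (rule filterlim_tendsto_add_at_top[OF tendsto_const])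
  show "\<forall>\<^sub>F n in sequentially. - 1 + a ^ n \<le> real (lacunary a n)"
    using lacunary_bounds(3)[OF assms] by (intro always_eventually allI) (smt (verit))
qed

lemma lacunary_ratio:
  assumes "a > 1"
  shows "(\<lambda>n. real (lacunary a (Suc n)) / real (lacunary a n)) \<longlonglongrightarrow> a"
proof -
  have inv: "(\<lambda>n. 1 / a ^ n) \<longlonglongrightarrow> 0"
    using LIMSEQ_inverse_realpow_zero[OF assms] by (simp add: divide_inverse)
  have norm: "(\<lambda>n. real (lacunary a n) / a ^ n) \<longlonglongrightarrow> 1"
  proof (rule real_tendsto_sandwich)
    show "(\<lambda>n. 1 - 1 / a ^ n) \<longlonglongrightarrow> 1" using tendsto_diff[OF tendsto_const inv] by simp
    have "1 - 1 / a ^ n \<le> real (lacunary a n) / a ^ n" for n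
    proof -
      have "(a ^ n - 1) / a ^ n \<le> real (lacunary a n) / a ^ n"
        using lacunary_bounds(3)[OF assms, of n] assms by (intro divide_right_mono) auto
      then show ?thesis using assms by (simp add: diff_divide_distrib)
    qed
    then show "\<forall>\<^sub>F n in sequentially. 1 - 1 / a ^ n \<le> real (lacunary a n) / a ^ n"
      by simp
    show "\<forall>\<^sub>F n in sequentially. real (lacunary a n) / a ^ n \<le> 1"
      using lacunary_bounds(2)[OF assms] assms by (intro always_eventually allI) (simp add: field_simps)
  qed simp
  have "(\<lambda>n. a * ((real (lacunary a (Suc n)) / a ^ Suc n) / (real (lacunary a n) / a ^ n))) \<longlonglongrightarrow> a * (1 / 1)"
    by (intro tendsto_intros LIMSEQ_Suc norm) simp
  moreover have "a * ((real (lacunary a (Suc n)) / a ^ Suc n) / (real (lacunary a n) / a ^ n))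
      = real (lacunary a (Suc n)) / real (lacunary a n)" for n
    using assms lacunary_bounds(1)[OF assms, of n] by (simp add: field_simps)
  ultimately show ?thesis by (simp only: div_by_1 mult_1_right)
qed

text \<open>
  The partial sums are monotone. An index \<open>m\<close> between consecutive lacunary indices \<open>k \<le> m \<le> k'\<close>
  therefore has its average between \<open>S k / k'\<close> and \<open>S k' / k\<close>, which tend to
  \<open>\<mu> / a\<close> and \<open>\<mu> * a\<close> because \<open>k' / k\<close> tends to \<open>a\<close>. The ratios \<open>1 + 1 / (j + 1)\<close> are
  countably many, as almost sure statements require, and come arbitrarily close to 1.
\<close>

lemma averages_tendsto_from_lacunary:
  fixes y :: "nat \<Rightarrow> real"
  assumes nonneg: "\<And>i. 0 \<le> y i"
    and lac: "\<And>j::nat. (\<lambda>n. (\<Sum>i=1..lacunary (1 + 1 / real (Suc j)) n. y i)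
                / real (lacunary (1 + 1 / real (Suc j)) n)) \<longlonglongrightarrow> \<mu>"
  shows "(\<lambda>n. (\<Sum>i=1..n. y i) / real n) \<longlonglongrightarrow> \<mu>"
proof -
  define S where "S n = (\<Sum>i=1..n. y i)" for n
  define \<alpha> where "\<alpha> j = 1 + 1 / real (Suc j)" for j
  have \<alpha>1: "\<alpha> j > 1" for j by (simp add: \<alpha>_def)
  have \<alpha>lim: "\<alpha> \<longlonglongrightarrow> 1"
    unfolding \<alpha>_def using tendsto_add[OF tendsto_const LIMSEQ_inverse_real_of_nat, of 1]
    by (simp add: divide_inverse)
  have Smono: "S m \<le> S n" if "m \<le> n" for m n
    unfolding S_def using that nonneg by (intro sum_mono2) auto
  have S0: "0 \<le> S n" for n unfolding S_def by (intro sum_nonneg nonneg)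
  have squeeze: "\<exists>l u. l \<longlonglongrightarrow> \<mu> / \<alpha> j \<and> u \<longlonglongrightarrow> \<mu> * \<alpha> j \<and>
      (\<forall>m\<ge>1. l m \<le> S m / real m \<and> S m / real m \<le> u m)" for j
  proof -
    define k where "k = lacunary (\<alpha> j)"
    define r where "r m = nat \<lfloor>log (\<alpha> j) (real m)\<rfloor>" for m :: nat
    have k1: "1 \<le> k n" for n unfolding k_def using lacunary_bounds(1)[OF \<alpha>1] by simp
    have k0: "0 < real (k n)" for n using k1[of n] by linarith
    have "filterlim (\<lambda>m. (1 / ln (\<alpha> j)) * ln (real m)) at_top sequentially"
      using \<alpha>1[of j]
      by (intro filterlim_tendsto_pos_mult_at_top[OF tendsto_const]
            filterlim_compose[OF ln_at_top filterlim_real_sequentially]) simp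
    then have "filterlim (\<lambda>m. log (\<alpha> j) (real m)) at_top sequentially"
      by (simp add: log_def)
    then have "filterlim r at_top sequentially"
      unfolding r_def
      by (intro filterlim_compose[OF filterlim_nat_sequentially]
            filterlim_compose[OF filterlim_floor_sequentially])
    note r_lim = this
    have kS: "(\<lambda>n. S (k n) / real (k n)) \<longlonglongrightarrow> \<mu>"
      using lac[of j] unfolding S_def k_def \<alpha>_def by simp
    have ratio: "(\<lambda>n. real (k (Suc n)) / real (k n)) \<longlonglongrightarrow> \<alpha> j"
      unfolding k_def by (rule lacunary_ratio[OF \<alpha>1])
    have l: "(\<lambda>n. S (k n) / real (k n) / (real (k (Suc n)) / real (k n))) \<longlonglongrightarrow> \<mu> / \<alpha> j"
      using \<alpha>1[of j] by (intro tendsto_divide kS ratio) auto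
    have u: "(\<lambda>n. S (k (Suc n)) / real (k (Suc n)) * (real (k (Suc n)) / real (k n))) \<longlonglongrightarrow> \<mu> * \<alpha> j"
      by (intro tendsto_mult ratio LIMSEQ_Suc kS)
    have between: "k (r m) \<le> m \<and> m \<le> k (Suc (r m))" if m: "m \<ge> 1" for m
    proof -
      have "log (\<alpha> j) (real m) \<ge> 0" using m \<alpha>1[of j] by simp
      then have "real (r m) \<le> log (\<alpha> j) (real m)" "log (\<alpha> j) (real m) < real (Suc (r m))"
        unfolding r_def by linarith+
      then have "\<alpha> j powr real (r m) \<le> real m" "real m < \<alpha> j powr real (Suc (r m))"
        using m \<alpha>1[of j] by (simp_all add: le_log_iff log_less_iff)
      then have "\<alpha> j ^ r m \<le> real m" "real m < \<alpha> j ^ Suc (r m)"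
        using powr_realpow[of "\<alpha> j" "r m"] powr_realpow[of "\<alpha> j" "Suc (r m)"] \<alpha>1[of j]
        by linarith+
      then have "real (k (r m)) \<le> real m" "real m < real (k (Suc (r m))) + 1"
        unfolding k_def
        using lacunary_bounds(2)[OF \<alpha>1, of j "r m"] lacunary_bounds(3)[OF \<alpha>1, of j "Suc (r m)"]
        by linarith+
      then show ?thesis by linarith
    qed
    show ?thesis
    proof (intro exI conjI allI impI)
      show "(\<lambda>m. S (k (r m)) / real (k (r m)) / (real (k (Suc (r m))) / real (k (r m)))) \<longlonglongrightarrow> \<mu> / \<alpha> j"
        by (rule filterlim_compose[OF l r_lim])
      show "(\<lambda>m. S (k (Suc (r m))) / real (k (Suc (r m))) * (real (k (Suc (r m))) / real (k (r m))))
          \<longlonglongrightarrow> \<mu> * \<alpha> j"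
        by (rule filterlim_compose[OF u r_lim])
      fix m :: nat assume m: "m \<ge> 1"
      have "S (k (r m)) / real (k (r m)) / (real (k (Suc (r m))) / real (k (r m)))
          = S (k (r m)) / real (k (Suc (r m)))"
        using k0[of "r m"] by simp
      also have "\<dots> \<le> S m / real m"
        using between[OF m] m S0 by (intro frac_le Smono) auto
      finally show "S (k (r m)) / real (k (r m)) / (real (k (Suc (r m))) / real (k (r m))) \<le> S m / real m" .
      have "S m / real m \<le> S (k (Suc (r m))) / real (k (r m))"
        using between[OF m] k0 S0 by (intro frac_le Smono) auto
      also have "\<dots> = S (k (Suc (r m))) / real (k (Suc (r m))) * (real (k (Suc (r m))) / real (k (r m)))"
        using k0[of "Suc (r m)"] by simp
      finally show "S m / real m
          \<le> S (k (Suc (r m))) / real (k (Suc (r m))) * (real (k (Suc (r m))) / real (k (r m)))" .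
    qed
  qed
  have "(\<lambda>m. S m / real m) \<longlonglongrightarrow> \<mu>"
  proof (rule order_tendstoI)
    fix b assume "b < \<mu>"
    moreover have "(\<lambda>j. \<mu> / \<alpha> j) \<longlonglongrightarrow> \<mu> / 1" by (intro tendsto_divide \<alpha>lim) auto
    ultimately have "\<forall>\<^sub>F j in sequentially. b < \<mu> / \<alpha> j" by (simp add: order_tendstoD)
    then obtain j where j: "b < \<mu> / \<alpha> j" by (auto simp: eventually_sequentially)
    obtain l where l: "l \<longlonglongrightarrow> \<mu> / \<alpha> j" "\<forall>m\<ge>1. l m \<le> S m / real m" using squeeze by blast
    from order_tendstoD(1)[OF l(1) j] eventually_ge_at_top[of 1]
    show "\<forall>\<^sub>F m in sequentially. b < S m / real m"
      by eventually_elim (use l(2) less_le_trans in blast)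
  next
    fix b assume "\<mu> < b"
    moreover have "(\<lambda>j. \<mu> * \<alpha> j) \<longlonglongrightarrow> \<mu> * 1" by (intro tendsto_mult \<alpha>lim) auto
    ultimately have "\<forall>\<^sub>F j in sequentially. \<mu> * \<alpha> j < b" by (simp add: order_tendstoD)
    then obtain j where j: "\<mu> * \<alpha> j < b" by (auto simp: eventually_sequentially)
    obtain u where u: "u \<longlonglongrightarrow> \<mu> * \<alpha> j" "\<forall>m\<ge>1. S m / real m \<le> u m" using squeeze by blast
    from order_tendstoD(2)[OF u(1) j] eventually_ge_at_top[of 1]
    show "\<forall>\<^sub>F m in sequentially. S m / real m < b"
      by eventually_elim (use u(2) le_less_trans in blast)
  qed
  then show ?thesis by (simp add: S_def)
qed

text \<open>
  Only the indices \<open>n\<close> with \<open>a ^ n \<ge> y\<close> contribute, and the remaining geometric series is of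
  order \<open>1 / y\<close>. One factor \<open>y\<close> survives, so that after integration a first moment bounds a
  sum of truncated second moments.
\<close>

lemma suminf_lacunary_tail_le:
  assumes a: "a > 1" and y: "0 \<le> y"
  shows "(\<Sum>n. ennreal (y\<^sup>2 * of_bool (y \<le> real (lacunary a n)) / real (lacunary a n)))
      \<le> ennreal (2 * a / (a - 1) * y)"
proof (cases "y = 0")
  case False
  then have y0: "y > 0" using y by simp
  define N where "N = (LEAST n. y \<le> a ^ n)"
  have ex: "\<exists>n. y \<le> a ^ n" using real_arch_pow[OF a, of y] less_imp_le by blast
  have N: "y \<le> a ^ N" unfolding N_def using ex by (rule LeastI_ex)
  have Nle: "N \<le> n" if "y \<le> a ^ n" for n unfolding N_def using that by (rule Least_le)
  \<comment> \<open>the factor 2 pays for rounding down: \<open>a ^ n \<le> 2 * lacunary a n\<close>\<close>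
  define f where "f n = (if N \<le> n then 2 * y\<^sup>2 * (1 / a) ^ n else 0)" for n
  have f0: "0 \<le> f n" for n using a by (simp add: f_def)
  have "(\<lambda>i. f (i + N)) sums (2 * y\<^sup>2 * (1 / a) ^ N * (1 / (1 - 1 / a)))"
  proof -
    have "(\<lambda>i. (1 / a) ^ i) sums (1 / (1 - 1 / a))" using a by (intro geometric_sums) simp
    then have "(\<lambda>i. 2 * y\<^sup>2 * (1 / a) ^ N * (1 / a) ^ i) sums (2 * y\<^sup>2 * (1 / a) ^ N * (1 / (1 - 1 / a)))"
      by (rule sums_mult)
    then show ?thesis by (simp add: f_def power_add mult_ac)
  qed
  then have fs: "f sums (2 * y\<^sup>2 * (1 / a) ^ N * (1 / (1 - 1 / a)))"
    by (subst (asm) sums_iff_shift) (simp add: f_def)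
  have le: "y\<^sup>2 * of_bool (y \<le> real (lacunary a n)) / real (lacunary a n) \<le> f n" for n
  proof (cases "y \<le> real (lacunary a n)")
    case True
    then have "N \<le> n" using lacunary_bounds(2)[OF a, of n] by (intro Nle) linarith
    moreover have "a ^ n \<le> 2 * real (lacunary a n)"
      using lacunary_bounds(1,3)[OF a, of n] by linarith
    then have "1 / real (lacunary a n) \<le> 2 / a ^ n"
      using a lacunary_bounds(1)[OF a, of n] by (simp add: field_simps)
    then have "y\<^sup>2 * (1 / real (lacunary a n)) \<le> y\<^sup>2 * (2 / a ^ n)" by (rule mult_left_mono) simp
    ultimately show ?thesis using True by (simp add: f_def power_one_over mult_ac)
  qed (use f0 in simp)
  have "(\<Sum>n. ennreal (y\<^sup>2 * of_bool (y \<le> real (lacunary a n)) / real (lacunary a n))) \<le> (\<Sum>n. ennreal (f n))"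
    by (intro suminf_le ennreal_leI le) auto
  also have "\<dots> = ennreal (2 * y\<^sup>2 * (1 / a) ^ N * (1 / (1 - 1 / a)))"
    using fs f0 by (metis sums_iff suminf_ennreal2)
  also have "\<dots> \<le> ennreal (2 * a / (a - 1) * y)"
  proof (rule ennreal_leI)
    have "y * (1 / a) ^ N \<le> 1" using N a by (simp add: power_one_over field_simps)
    then have "2 * a / (a - 1) * y * (y * (1 / a) ^ N) \<le> 2 * a / (a - 1) * y * 1"
      using a y by (intro mult_left_mono) auto
    moreover have "2 * y\<^sup>2 * (1 / a) ^ N * (1 / (1 - 1 / a)) = 2 * a / (a - 1) * y * (y * (1 / a) ^ N)"
      using a by (simp add: field_simps power2_eq_square)
    ultimately show "2 * y\<^sup>2 * (1 / a) ^ N * (1 / (1 - 1 / a)) \<le> 2 * a / (a - 1) * y" by simp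
  qed
  finally show ?thesis .
qed simp

lemma suminf_count_below_le:
  assumes "0 \<le> y"
  shows "(\<Sum>i. ennreal (of_bool (real (Suc i) < y))) \<le> ennreal y"
proof -
  have "(\<Sum>i. ennreal (of_bool (real (Suc i) < y))) = (\<Sum>i<nat \<lfloor>y\<rfloor>. ennreal (of_bool (real (Suc i) < y)))"
    by (rule suminf_finite) (auto, linarith)
  also have "\<dots> \<le> (\<Sum>i<nat \<lfloor>y\<rfloor>. 1)" by (intro sum_mono) auto
  also have "\<dots> = ennreal (real (nat \<lfloor>y\<rfloor>))" by (simp add: ennreal_of_nat_eq_real_of_nat)
  also have "\<dots> \<le> ennreal y" using assms by (intro ennreal_leI) linarith
  finally show ?thesis .
qed

context prob_space
begin

lemma expectation_eq_of_distr_eq: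
  fixes f :: "real \<Rightarrow> real"
  assumes [measurable]: "random_variable borel Y" "random_variable borel Z" "f \<in> borel_measurable borel"
    and eq: "distr M borel Y = distr M borel Z"
  shows "expectation (\<lambda>\<omega>. f (Y \<omega>)) = expectation (\<lambda>\<omega>. f (Z \<omega>))"
  using arg_cong[OF eq, of "\<lambda>D. integral\<^sup>L D f"] by (simp add: integral_distr)

lemma nn_integral_eq_of_distr_eq:
  fixes f :: "real \<Rightarrow> ennreal"
  assumes [measurable]: "random_variable borel Y" "random_variable borel Z" "f \<in> borel_measurable borel"
    and eq: "distr M borel Y = distr M borel Z"
  shows "(\<integral>\<^sup>+\<omega>. f (Y \<omega>) \<partial>M) = (\<integral>\<^sup>+\<omega>. f (Z \<omega>) \<partial>M)"
  using arg_cong[OF eq, of "\<lambda>D. integral\<^sup>N D f"] by (simp add: nn_integral_distr)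

text \<open>
  Pairwise uncorrelated centred variables are orthogonal, so that the variance of the average is
  the common variance divided by \<open>n\<close>; the variance is at most the second moment.
\<close>

lemma variance_average_iid_bounded:
  fixes Y :: "nat \<Rightarrow> 'a \<Rightarrow> real" and f :: "real \<Rightarrow> real"
  assumes indep: "indep_vars (\<lambda>_. borel) Y {1..}"
    and id: "\<And>i. i \<ge> 1 \<Longrightarrow> distr M borel (Y i) = distr M borel (Y 1)"
    and [measurable]: "f \<in> borel_measurable borel" and bounded: "\<And>x. \<bar>f x\<bar> \<le> B" and n: "n \<ge> 1"
  defines "m \<equiv> expectation (\<lambda>\<omega>. f (Y 1 \<omega>))"
  shows "integrable M (\<lambda>\<omega>. ((\<Sum>i=1..n. f (Y i \<omega>)) / real n - m)\<^sup>2)"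
    and "expectation (\<lambda>\<omega>. ((\<Sum>i=1..n. f (Y i \<omega>)) / real n - m)\<^sup>2)
           \<le> expectation (\<lambda>\<omega>. (f (Y 1 \<omega>))\<^sup>2) / real n"
proof -
  have meas: "random_variable borel (Y i)" if "i \<ge> 1" for i
    using indep that by (simp add: indep_vars_def)
  have [measurable]: "random_variable borel (Y (Suc i))" for i by (rule meas) simp
  have fint: "integrable M (\<lambda>\<omega>. f (Y i \<omega>))" if "i \<ge> 1" for i
    using meas[OF that] bounded by (intro integrable_const_bound[where B=B]) auto
  have mean: "expectation (\<lambda>\<omega>. f (Y i \<omega>)) = m" if "i \<ge> 1" for i
    unfolding m_def using that meas by (intro expectation_eq_of_distr_eq id) auto
  define W where "W i \<omega> = f (Y i \<omega>) - m" for i \<omega>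
  have Wmeas: "W i \<in> borel_measurable M" if "i \<ge> 1" for i
    unfolding W_def using meas[OF that] by measurable
  have Wint: "integrable M (W i)" if "i \<ge> 1" for i
    unfolding W_def using fint[OF that] by auto
  have W0: "expectation (W i) = 0" if "i \<ge> 1" for i
    unfolding W_def using fint[OF that] mean[OF that] by (simp add: prob_space)
  have Wb: "\<bar>W i \<omega>\<bar> \<le> B + \<bar>m\<bar>" for i \<omega>
    unfolding W_def using bounded[of "Y i \<omega>"] by linarith
  have WWint: "integrable M (\<lambda>\<omega>. W i \<omega> * W j \<omega>)" if "i \<ge> 1" "j \<ge> 1" for i j
  proof (rule integrable_const_bound[where B="(B + \<bar>m\<bar>) * (B + \<bar>m\<bar>)"])
    show "AE \<omega> in M. norm (W i \<omega> * W j \<omega>) \<le> (B + \<bar>m\<bar>) * (B + \<bar>m\<bar>)"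
      unfolding real_norm_def abs_mult
      by (intro AE_I2 mult_mono Wb order_trans[OF abs_ge_zero Wb] abs_ge_zero)
    show "(\<lambda>\<omega>. W i \<omega> * W j \<omega>) \<in> borel_measurable M"
      using Wmeas that by simp
  qed
  have orth: "expectation (\<lambda>\<omega>. W i \<omega> * W j \<omega>) = 0" if "i \<ge> 1" "j \<ge> 1" "i \<noteq> j" for i j
  proof -
    have "indep_vars (\<lambda>_. borel) (\<lambda>i \<omega>. (\<lambda>y. f y - m) (Y i \<omega>)) {1..}"
      by (rule indep_vars_compose2[OF indep]) measurable
    then have "indep_vars (\<lambda>_. borel) W {i, j}"
      unfolding W_def by (rule indep_vars_subset) (use that in auto)
    then have "expectation (\<lambda>\<omega>. \<Prod>l\<in>{i, j}. W l \<omega>) = (\<Prod>l\<in>{i, j}. expectation (W l))"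
      by (intro indep_vars_lebesgue_integral) (use Wint that in auto)
    then show ?thesis using that W0 by simp
  qed
  have sq: "((\<Sum>i=1..n. f (Y i \<omega>)) / real n - m)\<^sup>2 = (\<Sum>i=1..n. W i \<omega>)\<^sup>2 / (real n)\<^sup>2" for \<omega>
  proof -
    have "(\<Sum>i=1..n. f (Y i \<omega>)) / real n - m = (\<Sum>i=1..n. W i \<omega>) / real n"
      unfolding W_def using n by (simp add: sum_subtractf field_simps)
    then show ?thesis by (simp add: power_divide)
  qed
  show "integrable M (\<lambda>\<omega>. ((\<Sum>i=1..n. f (Y i \<omega>)) / real n - m)\<^sup>2)"
    unfolding sq by (intro integrable_divide integral_square_sum_orthogonal WWint orth) auto
  have f2int: "integrable M (\<lambda>\<omega>. (f (Y i \<omega>))\<^sup>2)" if "i \<ge> 1" for i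
  proof (rule integrable_const_bound[where B="B\<^sup>2"])
    show "AE \<omega> in M. norm ((f (Y i \<omega>))\<^sup>2) \<le> B\<^sup>2"
      using power_mono[OF bounded abs_ge_zero, of _ 2] by (intro AE_I2) simp
  qed (use meas[OF that] in measurable)
  have "expectation (\<lambda>\<omega>. (W i \<omega>)\<^sup>2) \<le> expectation (\<lambda>\<omega>. (f (Y 1 \<omega>))\<^sup>2)" if "i \<ge> 1" for i
  proof -
    have "expectation (\<lambda>\<omega>. (W i \<omega>)\<^sup>2) = expectation (\<lambda>\<omega>. (f (Y i \<omega>))\<^sup>2) - m\<^sup>2"
      unfolding W_def using variance_eq[OF fint[OF that] f2int[OF that]] mean[OF that] by simp
    moreover have "expectation (\<lambda>\<omega>. (f (Y i \<omega>))\<^sup>2) = expectation (\<lambda>\<omega>. (f (Y 1 \<omega>))\<^sup>2)"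
      using that meas by (intro expectation_eq_of_distr_eq[where f="\<lambda>y. (f y)\<^sup>2"] id) auto
    ultimately show ?thesis by simp
  qed
  then have le: "(\<Sum>i=1..n. expectation (\<lambda>\<omega>. (W i \<omega>)\<^sup>2)) \<le> real n * expectation (\<lambda>\<omega>. (f (Y 1 \<omega>))\<^sup>2)"
    using sum_bounded_above[of "{1..n}" "\<lambda>i. expectation (\<lambda>\<omega>. (W i \<omega>)\<^sup>2)"] by simp
  have "expectation (\<lambda>\<omega>. ((\<Sum>i=1..n. f (Y i \<omega>)) / real n - m)\<^sup>2)
      = (\<Sum>i=1..n. expectation (\<lambda>\<omega>. (W i \<omega>)\<^sup>2)) / (real n)\<^sup>2"
    unfolding sq using integral_square_sum_orthogonal(2)[of "{1..n}" M W] WWint orth by simp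
  also have "\<dots> \<le> real n * expectation (\<lambda>\<omega>. (f (Y 1 \<omega>))\<^sup>2) / (real n)\<^sup>2"
    by (intro divide_right_mono le) simp
  also have "\<dots> = expectation (\<lambda>\<omega>. (f (Y 1 \<omega>))\<^sup>2) / real n"
    using n by (simp add: power2_eq_square)
  finally show "expectation (\<lambda>\<omega>. ((\<Sum>i=1..n. f (Y i \<omega>)) / real n - m)\<^sup>2)
      \<le> expectation (\<lambda>\<omega>. (f (Y 1 \<omega>))\<^sup>2) / real n" .
qed

text \<open>
  The probabilities of \<open>Y i > i\<close> sum to the expected number of positive integers below \<open>Y 1\<close>,
  hence to at most the mean of \<open>Y 1\<close>.
\<close>

lemma AE_eventually_le_index:
  fixes Y :: "nat \<Rightarrow> 'a \<Rightarrow> real"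
  assumes meas: "\<And>i. i \<ge> 1 \<Longrightarrow> random_variable borel (Y i)"
    and id: "\<And>i. i \<ge> 1 \<Longrightarrow> distr M borel (Y i) = distr M borel (Y 1)"
    and nonneg: "\<And>i \<omega>. 0 \<le> Y i \<omega>" and int: "integrable M (Y 1)"
  shows "AE \<omega> in M. \<forall>\<^sub>F i in sequentially. Y i \<omega> \<le> real i"
proof -
  have [measurable]: "random_variable borel (Y (Suc i))" for i by (rule meas) simp
  have [measurable]: "random_variable borel (Y 1)" by (rule meas) simp
  have "(\<Sum>i. \<integral>\<^sup>+\<omega>. ennreal (of_bool (real (Suc i) < Y (Suc i) \<omega>)) \<partial>M)
      = (\<Sum>i. \<integral>\<^sup>+\<omega>. ennreal (of_bool (real (Suc i) < Y 1 \<omega>)) \<partial>M)"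
    by (intro suminf_cong
        nn_integral_eq_of_distr_eq[where f="\<lambda>y. ennreal (of_bool (real (Suc _) < y))"] id) auto
  also have "\<dots> = (\<integral>\<^sup>+\<omega>. (\<Sum>i. ennreal (of_bool (real (Suc i) < Y 1 \<omega>))) \<partial>M)"
    by (rule nn_integral_suminf[symmetric]) measurable
  also have "\<dots> \<le> (\<integral>\<^sup>+\<omega>. ennreal (Y 1 \<omega>) \<partial>M)"
    by (intro nn_integral_mono suminf_count_below_le nonneg)
  also have "\<dots> < \<infinity>" using int by (simp add: nn_integral_eq_integral nonneg)
  finally have "AE \<omega> in M. (\<lambda>i. of_bool (real (Suc i) < Y (Suc i) \<omega>) :: real) \<longlonglongrightarrow> 0"
    by (intro AE_tendsto_0_if_suminf_nn_integral_finite) auto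
  then show ?thesis
  proof eventually_elim
    case (elim \<omega>)
    then have "\<forall>\<^sub>F i in sequentially. (of_bool (real (Suc i) < Y (Suc i) \<omega>) :: real) < 1"
      by (rule order_tendstoD(2)) simp
    then have "\<forall>\<^sub>F i in sequentially. Y (Suc i) \<omega> \<le> real (Suc i)"
      by eventually_elim (auto split: if_splits simp: of_bool_def)
    then show ?case using eventually_sequentially_Suc by blast
  qed
qed

text \<open>
  All summands of the \<open>n\<close>-th average are truncated at the same level, the number \<open>k n\<close> of
  summands. This keeps them identically distributed, so that the mean of the truncated average is a
  single truncated mean, which converges by domination. The truncation changes the average for only
  finitely many \<open>n\<close>: almost surely \<open>Y i > i\<close> for finitely many \<open>i\<close> only, and these finitely
  many values lie below \<open>k n\<close> for large \<open>n\<close>.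
\<close>

lemma strong_law_along_lacunary:
  fixes Y :: "nat \<Rightarrow> 'a \<Rightarrow> real"
  assumes indep: "indep_vars (\<lambda>_. borel) Y {1..}"
    and id: "\<And>i. i \<ge> 1 \<Longrightarrow> distr M borel (Y i) = distr M borel (Y 1)"
    and nonneg: "\<And>i \<omega>. 0 \<le> Y i \<omega>" and int: "integrable M (Y 1)" and a: "a > 1"
  shows "AE \<omega> in M. (\<lambda>n. (\<Sum>i=1..lacunary a n. Y i \<omega>) / real (lacunary a n)) \<longlonglongrightarrow> expectation (Y 1)"
proof -
  have meas: "random_variable borel (Y i)" if "i \<ge> 1" for i
    using indep that by (simp add: indep_vars_def)
  have meas1[measurable]: "random_variable borel (Y 1)" by (rule meas) simp
  define k where "k = lacunary a"
  have k1: "k n \<ge> 1" for n unfolding k_def by (rule lacunary_bounds[OF a])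
  have k_top: "filterlim (\<lambda>n. real (k n)) at_top sequentially"
    unfolding k_def by (rule lacunary_at_top[OF a])
  \<comment> \<open>\<open>max 0 y\<close> makes the truncation bounded on the whole line; the values \<open>Y i \<omega>\<close> are
      nonnegative\<close>
  define t where "t n y = max 0 y * of_bool (y \<le> real (k n))" for n and y :: real
  have tm [measurable]: "t n \<in> borel_measurable borel" for n unfolding t_def by measurable
  have t_bound: "\<bar>t n y\<bar> \<le> real (k n)" for n y unfolding t_def by auto
  define m where "m n = expectation (\<lambda>\<omega>. t n (Y 1 \<omega>))" for n
  define Z where "Z n \<omega> = (\<Sum>i=1..k n. t n (Y i \<omega>)) / real (k n)" for n \<omega>
  have Zmeas [measurable]: "Z n \<in> borel_measurable M" for n
    unfolding Z_def using meas by measurable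
  have m_lim: "m \<longlonglongrightarrow> expectation (Y 1)"
    unfolding m_def
  proof (rule integral_dominated_convergence[where w="Y 1"])
    show "AE \<omega> in M. (\<lambda>n. t n (Y 1 \<omega>)) \<longlonglongrightarrow> Y 1 \<omega>"
    proof (intro AE_I2 tendsto_eventually)
      fix \<omega>
      have "\<forall>\<^sub>F n in sequentially. Y 1 \<omega> \<le> real (k n)"
        using k_top by (simp add: filterlim_at_top)
      then show "\<forall>\<^sub>F n in sequentially. t n (Y 1 \<omega>) = Y 1 \<omega>"
        by eventually_elim (simp add: t_def nonneg)
    qed
    show "AE \<omega> in M. norm (t n (Y 1 \<omega>)) \<le> Y 1 \<omega>" for n
      by (intro AE_I2) (simp add: t_def nonneg)
  qed (use int in auto)
  have var: "(\<integral>\<^sup>+\<omega>. ennreal ((Z n \<omega> - m n)\<^sup>2) \<partial>M)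
      \<le> (\<integral>\<^sup>+\<omega>. ennreal ((Y 1 \<omega>)\<^sup>2 * of_bool (Y 1 \<omega> \<le> real (k n)) / real (k n)) \<partial>M)" for n
  proof -
    have t2: "(t n (Y 1 \<omega>))\<^sup>2 = (Y 1 \<omega>)\<^sup>2 * of_bool (Y 1 \<omega> \<le> real (k n))" for \<omega>
      by (simp add: t_def nonneg)
    have int2: "integrable M (\<lambda>\<omega>. (t n (Y 1 \<omega>))\<^sup>2)"
    proof (rule integrable_const_bound[where B="(real (k n))\<^sup>2"])
      show "AE \<omega> in M. norm ((t n (Y 1 \<omega>))\<^sup>2) \<le> (real (k n))\<^sup>2"
        using power_mono[OF t_bound abs_ge_zero, of n _ 2] by (intro AE_I2) simp
    qed measurable
    note v = variance_average_iid_bounded[OF indep id tm t_bound k1, of n n, folded Z_def m_def]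
    have "(\<integral>\<^sup>+\<omega>. ennreal ((Z n \<omega> - m n)\<^sup>2) \<partial>M) = ennreal (expectation (\<lambda>\<omega>. (Z n \<omega> - m n)\<^sup>2))"
      by (rule nn_integral_eq_integral[OF v(1)]) auto
    also have "\<dots> \<le> ennreal (expectation (\<lambda>\<omega>. (t n (Y 1 \<omega>))\<^sup>2) / real (k n))"
      by (intro ennreal_leI v(2))
    also have "\<dots> = ennreal (expectation (\<lambda>\<omega>. (t n (Y 1 \<omega>))\<^sup>2 / real (k n)))" by simp
    also have "\<dots> = (\<integral>\<^sup>+\<omega>. ennreal ((t n (Y 1 \<omega>))\<^sup>2 / real (k n)) \<partial>M)"
      using int2 by (intro nn_integral_eq_integral[symmetric] integrable_divide) auto
    finally show ?thesis unfolding t2 .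
  qed
  have "(\<Sum>n. \<integral>\<^sup>+\<omega>. ennreal ((Z n \<omega> - m n)\<^sup>2) \<partial>M)
      \<le> (\<Sum>n. \<integral>\<^sup>+\<omega>. ennreal ((Y 1 \<omega>)\<^sup>2 * of_bool (Y 1 \<omega> \<le> real (k n)) / real (k n)) \<partial>M)"
    by (intro suminf_le var) auto
  also have "\<dots> = (\<integral>\<^sup>+\<omega>. (\<Sum>n. ennreal ((Y 1 \<omega>)\<^sup>2 * of_bool (Y 1 \<omega> \<le> real (k n)) / real (k n))) \<partial>M)"
    by (rule nn_integral_suminf[symmetric]) measurable
  also have "\<dots> \<le> (\<integral>\<^sup>+\<omega>. ennreal (2 * a / (a - 1) * Y 1 \<omega>) \<partial>M)"
    unfolding k_def by (intro nn_integral_mono suminf_lacunary_tail_le a nonneg)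
  also have "\<dots> = ennreal (expectation (\<lambda>\<omega>. 2 * a / (a - 1) * Y 1 \<omega>))"
    using a nonneg int by (intro nn_integral_eq_integral) auto
  also have "\<dots> < \<infinity>" by simp
  finally have "AE \<omega> in M. (\<lambda>n. (Z n \<omega> - m n)\<^sup>2) \<longlonglongrightarrow> 0"
    by (intro AE_tendsto_0_if_suminf_nn_integral_finite) auto
  moreover have "AE \<omega> in M. \<forall>\<^sub>F i in sequentially. Y i \<omega> \<le> real i"
    by (intro AE_eventually_le_index meas id nonneg int)
  ultimately show ?thesis
  proof eventually_elim
    case (elim \<omega>)
    have "(\<lambda>n. sqrt ((Z n \<omega> - m n)\<^sup>2)) \<longlonglongrightarrow> sqrt 0" by (intro tendsto_real_sqrt elim)
    then have "(\<lambda>n. Z n \<omega> - m n) \<longlonglongrightarrow> 0" by (simp add: tendsto_rabs_zero_iff)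
    from tendsto_add[OF this m_lim] have Zlim: "(\<lambda>n. Z n \<omega>) \<longlonglongrightarrow> expectation (Y 1)" by simp
    obtain N where N: "Y i \<omega> \<le> real i" if "i \<ge> N" for i
      using elim(2) by (auto simp: eventually_sequentially)
    \<comment> \<open>a crude common bound for the finitely many \<open>Y i \<omega>\<close> that may exceed their index\<close>
    define b where "b = (\<Sum>i<N. Y i \<omega>)"
    have "\<forall>\<^sub>F n in sequentially. b \<le> real (k n)"
      using k_top by (simp add: filterlim_at_top)
    then have "\<forall>\<^sub>F n in sequentially. Z n \<omega> = (\<Sum>i=1..k n. Y i \<omega>) / real (k n)"
    proof eventually_elim
      case (elim n)
      have "Y i \<omega> \<le> real (k n)" if "i \<le> k n" for i
      proof (cases "i < N")
        case True
        then have "Y i \<omega> \<le> b" unfolding b_def by (intro member_le_sum nonneg) auto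
        then show ?thesis using elim by simp
      next
        case False
        then have "Y i \<omega> \<le> real i" by (intro N) simp
        then show ?thesis using that by simp
      qed
      then show ?case by (simp add: Z_def t_def nonneg)
    qed
    with Zlim show ?case unfolding k_def[symmetric]
      by (rule Lim_transform_eventually)
  qed
qed

text \<open>
  Etemadi's strong law: nonnegativity and a finite mean suffice. This matters here because
  \<open>x powr (- 1 / 2)\<close> is only assumed to have a first moment.
\<close>

theorem strong_law_of_large_numbers_nonneg:
  fixes Y :: "nat \<Rightarrow> 'a \<Rightarrow> real"
  assumes indep: "indep_vars (\<lambda>_. borel) Y {1..}"
    and id: "\<And>i. i \<ge> 1 \<Longrightarrow> distr M borel (Y i) = distr M borel (Y 1)"
    and nonneg: "\<And>i \<omega>. 0 \<le> Y i \<omega>" and int: "integrable M (Y 1)"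
  shows "AE \<omega> in M. (\<lambda>n. (\<Sum>i=1..n. Y i \<omega>) / real n) \<longlonglongrightarrow> expectation (Y 1)"
proof -
  have "AE \<omega> in M. \<forall>j::nat. (\<lambda>n. (\<Sum>i=1..lacunary (1 + 1 / real (Suc j)) n. Y i \<omega>)
      / real (lacunary (1 + 1 / real (Suc j)) n)) \<longlonglongrightarrow> expectation (Y 1)"
    unfolding AE_all_countable
    by (intro allI strong_law_along_lacunary indep id nonneg int) auto
  then show ?thesis
    by eventually_elim (rule averages_tendsto_from_lacunary, auto simp: nonneg)
qed

end

section \<open>Square-integrable and \<open>k\<close>-monotone functions\<close>

lemma antimono_on_pos_le:
  fixes f :: "real \<Rightarrow> real"
  shows "antimono_on {0<..} f \<Longrightarrow> 0 < x \<Longrightarrow> x \<le> y \<Longrightarrow> f y \<le> f x"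
  by (auto simp: monotone_on_def)

lemma convex_on_cong_on:
  assumes f: "convex_on S f" and eq: "\<And>x. x \<in> S \<Longrightarrow> f x = g x"
  shows "convex_on S g"
  unfolding convex_on_def
proof (intro conjI ballI allI impI)
  show S: "convex S" using f by (simp add: convex_on_def)
  fix x y and u v :: real assume xy: "x \<in> S" "y \<in> S" and uv: "0 \<le> u" "0 \<le> v" "u + v = 1"
  have "f (u *\<^sub>R x + v *\<^sub>R y) \<le> u * f x + v * f y" using f xy uv by (simp add: convex_on_def)
  moreover have "u *\<^sub>R x + v *\<^sub>R y \<in> S" using S xy uv by (simp add: convex_def)
  ultimately show "g (u *\<^sub>R x + v *\<^sub>R y) \<le> u * g x + v * g y" using eq xy by simp
qed

lemma L2_mult_integrable:
  assumes f: "f \<in> L2" and g: "g \<in> L2"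
  shows "set_integrable lborel {0<..} (\<lambda>x. f x * g x)"
proof (rule set_integrable_bound)
  show "set_integrable lborel {0<..} (\<lambda>x. (f x)\<^sup>2 + (g x)\<^sup>2)"
    using f g by (auto simp: L2_def)
  have "(\<lambda>x. (indicator {0<..} x *\<^sub>R f x) * (indicator {0<..} x *\<^sub>R g x)) \<in> borel_measurable lborel"
    using f g unfolding L2_def set_borel_measurable_def by (intro borel_measurable_times) auto
  also have "(\<lambda>x. (indicator {0<..} x *\<^sub>R f x) * (indicator {0<..} x *\<^sub>R g x))
      = (\<lambda>x. indicator {0<..} x *\<^sub>R (f x * g x))"
    by (auto simp: indicator_def)
  finally show "set_borel_measurable lborel {0<..} (\<lambda>x. f x * g x)"
    unfolding set_borel_measurable_def .
  have "\<bar>f x * g x\<bar> \<le> (f x)\<^sup>2 + (g x)\<^sup>2" for x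
  proof -
    have "2 * (\<bar>f x\<bar> * \<bar>g x\<bar>) \<le> \<bar>f x\<bar>\<^sup>2 + \<bar>g x\<bar>\<^sup>2"
      using sum_squares_bound[of "\<bar>f x\<bar>" "\<bar>g x\<bar>"] by (simp add: mult_ac)
    moreover have "0 \<le> \<bar>f x\<bar> * \<bar>g x\<bar>" by simp
    ultimately have "\<bar>f x\<bar> * \<bar>g x\<bar> \<le> \<bar>f x\<bar>\<^sup>2 + \<bar>g x\<bar>\<^sup>2" by linarith
    then show ?thesis by (simp add: abs_mult)
  qed
  then show "AE x in lborel. x \<in> {0<..} \<longrightarrow> norm (f x * g x) \<le> norm ((f x)\<^sup>2 + (g x)\<^sup>2)"
    by simp
qed

lemma square_lincomb:
  fixes a b u v :: real
  shows "(a * u + b * v)\<^sup>2 = a\<^sup>2 * u\<^sup>2 + 2 * a * b * (u * v) + b\<^sup>2 * v\<^sup>2"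
  by (simp add: power2_eq_square algebra_simps)

lemma L2_lincomb:
  assumes f: "f \<in> L2" and g: "g \<in> L2"
  shows "(\<lambda>x. a * f x + b * g x) \<in> L2"
    and "(LINT x:{0<..}|lborel. (a * f x + b * g x)\<^sup>2) =
      a\<^sup>2 * (LINT x:{0<..}|lborel. (f x)\<^sup>2) + 2 * a * b * (LINT x:{0<..}|lborel. f x * g x)
        + b\<^sup>2 * (LINT x:{0<..}|lborel. (g x)\<^sup>2)"
proof -
  have i: "set_integrable lborel {0<..} (\<lambda>x. (f x)\<^sup>2)" "set_integrable lborel {0<..} (\<lambda>x. (g x)\<^sup>2)"
    using f g by (auto simp: L2_def)
  note fg = L2_mult_integrable[OF f g]
  have "(\<lambda>x. a * (indicator {0<..} x *\<^sub>R f x) + b * (indicator {0<..} x *\<^sub>R g x)) \<in> borel_measurable lborel"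
    using f g unfolding L2_def set_borel_measurable_def
    by (intro borel_measurable_add borel_measurable_times) auto
  also have "(\<lambda>x. a * (indicator {0<..} x *\<^sub>R f x) + b * (indicator {0<..} x *\<^sub>R g x))
      = (\<lambda>x. indicator {0<..} x *\<^sub>R (a * f x + b * g x))"
    by (auto simp: indicator_def)
  finally have "set_borel_measurable lborel {0<..} (\<lambda>x. a * f x + b * g x)"
    unfolding set_borel_measurable_def .
  moreover have "set_integrable lborel {0<..} (\<lambda>x. (a * f x + b * g x)\<^sup>2)"
    unfolding square_lincomb by (intro set_integral_add set_integrable_mult_right i fg)
  ultimately show "(\<lambda>x. a * f x + b * g x) \<in> L2" by (simp add: L2_def)
  show "(LINT x:{0<..}|lborel. (a * f x + b * g x)\<^sup>2) =
      a\<^sup>2 * (LINT x:{0<..}|lborel. (f x)\<^sup>2) + 2 * a * b * (LINT x:{0<..}|lborel. f x * g x)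
        + b\<^sup>2 * (LINT x:{0<..}|lborel. (g x)\<^sup>2)"
    unfolding square_lincomb by (simp add: set_integral_add set_integrable_mult_right i fg)
qed

lemma L2_diff:
  assumes "f \<in> L2" "g \<in> L2"
  shows "(\<lambda>x. f x - g x) \<in> L2"
    and "(LINT x:{0<..}|lborel. (f x - g x)\<^sup>2) = (LINT x:{0<..}|lborel. (f x)\<^sup>2)
        - 2 * (LINT x:{0<..}|lborel. f x * g x) + (LINT x:{0<..}|lborel. (g x)\<^sup>2)"
  using L2_lincomb[OF assms, of 1 "-1"] by simp_all

lemma square_integral_nonneg: "0 \<le> (LINT x:{0<..}|lborel. (f x)\<^sup>2 :: real)"
  unfolding set_lebesgue_integral_def by (intro Bochner_Integration.integral_nonneg) simp

lemma L2_norm_square: "(L2_norm f)\<^sup>2 = (LINT x:{0<..}|lborel. (f x)\<^sup>2)"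
  unfolding L2_norm_def by (simp add: square_integral_nonneg)

lemma L2_norm_nonneg: "0 \<le> L2_norm f"
  unfolding L2_norm_def by (simp add: square_integral_nonneg)

text \<open>
  Both pointwise bounds of the development come from this estimate: a large value that
  monotonicity propagates to an interval costs square mass there.
\<close>

lemma square_integral_ge_on_interval:
  assumes f: "f \<in> L2" and ab: "0 \<le> a" "a \<le> b"
    and low: "\<And>y. a < y \<Longrightarrow> y < b \<Longrightarrow> s \<le> \<bar>f y\<bar>" and s: "0 \<le> s"
  shows "(b - a) * s\<^sup>2 \<le> (LINT x:{0<..}|lborel. (f x)\<^sup>2)"
proof -
  have "(b - a) * s\<^sup>2 = (\<integral>x. indicator {a<..<b} x * s\<^sup>2 \<partial>lborel)" using ab by simp
  also have "\<dots> \<le> (\<integral>x. indicator {0<..} x *\<^sub>R (f x)\<^sup>2 \<partial>lborel)"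
  proof (rule integral_mono)
    show "integrable lborel (\<lambda>x. indicator {a<..<b} x * s\<^sup>2)"
      using ab by (intro integrable_mult_left) (auto intro!: integrable_real_indicator)
    show "integrable lborel (\<lambda>x. indicator {0<..} x *\<^sub>R (f x)\<^sup>2)"
      using f by (simp add: L2_def set_integrable_def)
    show "indicator {a<..<b} x * s\<^sup>2 \<le> indicator {0<..} x *\<^sub>R (f x)\<^sup>2" for x
      using low[of x] ab s by (auto simp: indicator_def abs_le_square_iff[symmetric])
  qed
  finally show ?thesis by (simp add: set_lebesgue_integral_def)
qed

text \<open>
  On \<open>(0, x)\<close> the function is at least \<open>f x\<close>, so its square integral is at least
  \<open>x * (f x)\<^sup>2\<close>. This is the origin of the weight \<open>x powr (- 1 / 2)\<close>.
\<close>

lemma decreasing_le_L2_norm: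
  assumes f: "f \<in> L2" and nonneg: "\<And>y. 0 < y \<Longrightarrow> 0 \<le> f y" and anti: "antimono_on {0<..} f" and x: "0 < x"
  shows "f x \<le> L2_norm f * x powr (- 1 / 2)"
proof -
  have "(x - 0) * (f x)\<^sup>2 \<le> (LINT t:{0<..}|lborel. (f t)\<^sup>2)"
  proof (rule square_integral_ge_on_interval[OF f])
    fix y assume "0 < y" "y < x"
    then have "f x \<le> f y" by (intro antimono_on_pos_le[OF anti]) auto
    then show "f x \<le> \<bar>f y\<bar>" by linarith
  qed (use x nonneg in auto)
  then have "sqrt (x * (f x)\<^sup>2) \<le> L2_norm f" unfolding L2_norm_def by simp
  then have "sqrt x * f x \<le> L2_norm f" using nonneg[OF x] by (simp add: real_sqrt_mult)
  moreover have "x powr (- 1 / 2) = 1 / sqrt x"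
    using x powr_minus_divide[of x "1 / 2"] by (simp add: powr_half_sqrt)
  ultimately show ?thesis using x by (simp only:) (simp add: field_simps)
qed

lemma k_monotone_nonneg: "g \<in> k_monotone k \<Longrightarrow> 0 < x \<Longrightarrow> 0 \<le> g x"
  and k_monotone_antimono: "g \<in> k_monotone k \<Longrightarrow> antimono_on {0<..} g"
  and k_monotone_convex: "g \<in> k_monotone k \<Longrightarrow> convex_on {0<..} g"
proof -
  assume "g \<in> k_monotone k"
  then have "(\<forall>x>0. 0 \<le> (- 1) ^ 0 * (deriv ^^ 0) g x) \<and>
      antimono_on {0<..} (\<lambda>x. (- 1) ^ 0 * (deriv ^^ 0) g x) \<and>
      convex_on {0<..} (\<lambda>x. (- 1) ^ 0 * (deriv ^^ 0) g x)"
    unfolding k_monotone_def by blast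
  then show "0 < x \<Longrightarrow> 0 \<le> g x" "antimono_on {0<..} g" "convex_on {0<..} g" by simp_all
qed

text \<open>
  As \<^const>\<open>deriv\<close> is total, linearity needs differentiability of each lower derivative; this is
  available on the half-line only, so the induction rewrites derivatives in a neighbourhood of
  each of its points.
\<close>

lemma higher_deriv_lincomb_on_pos:
  fixes f g :: "real \<Rightarrow> real"
  assumes "\<And>l x. l < m \<Longrightarrow> 0 < x \<Longrightarrow> (deriv ^^ l) f field_differentiable at x"
    and "\<And>l x. l < m \<Longrightarrow> 0 < x \<Longrightarrow> (deriv ^^ l) g field_differentiable at x"
  shows "l \<le> m \<Longrightarrow> 0 < x \<Longrightarrow>
    (deriv ^^ l) (\<lambda>x. a * f x + b * g x) x = a * (deriv ^^ l) f x + b * (deriv ^^ l) g x"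
proof (induction l arbitrary: x)
  case (Suc l)
  have "eventually (\<lambda>y. y \<in> {0<..}) (nhds x)"
    using Suc.prems by (intro eventually_nhds_in_open) auto
  then have "eventually (\<lambda>y. (deriv ^^ l) (\<lambda>x. a * f x + b * g x) y
      = a * (deriv ^^ l) f y + b * (deriv ^^ l) g y) (nhds x)"
    by eventually_elim (use Suc in auto)
  then have "deriv ((deriv ^^ l) (\<lambda>x. a * f x + b * g x)) x
      = deriv (\<lambda>y. a * (deriv ^^ l) f y + b * (deriv ^^ l) g y) x"
    by (rule deriv_cong_ev) simp
  also have "\<dots> = a * deriv ((deriv ^^ l) f) x + b * deriv ((deriv ^^ l) g) x"
    using assms[of l x] Suc.prems
    by (intro DERIV_imp_deriv DERIV_add DERIV_cmult)
      (auto simp: DERIV_deriv_iff_field_differentiable)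
  finally show ?case by simp
qed simp

lemma k_monotone_lincomb:
  assumes f: "f \<in> k_monotone k" and g: "g \<in> k_monotone k" and ab: "0 \<le> a" "0 \<le> b"
  shows "(\<lambda>x. a * f x + b * g x) \<in> k_monotone k"
proof -
  define h where "h = (\<lambda>x. a * f x + b * g x)"
  have df: "(deriv ^^ l) f field_differentiable at x" and dg: "(deriv ^^ l) g field_differentiable at x"
    if "l < k - 2" "0 < x" for l x
    using f g that by (auto simp: k_monotone_def)
  have h: "(deriv ^^ l) h x = a * (deriv ^^ l) f x + b * (deriv ^^ l) g x" if "l \<le> k - 2" "0 < x" for l x
    unfolding h_def using that by (intro higher_deriv_lincomb_on_pos[where m="k - 2"] df dg)
  have "(deriv ^^ l) h field_differentiable at x" if "l < k - 2" "0 < x" for l x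
  proof -
    have "(\<lambda>y. a * (deriv ^^ l) f y + b * (deriv ^^ l) g y) field_differentiable at x"
      using df[OF that] dg[OF that] by (intro derivative_intros) auto
    then show ?thesis
      by (rule field_differentiable_transform_within[of x x, rotated 3])
        (use that h in \<open>auto simp: dist_real_def\<close>)
  qed
  moreover have "\<forall>x>0. 0 \<le> (- 1) ^ l * (deriv ^^ l) h x"
    and "antimono_on {0<..} (\<lambda>x. (- 1) ^ l * (deriv ^^ l) h x)"
    and "convex_on {0<..} (\<lambda>x. (- 1) ^ l * (deriv ^^ l) h x)" if l: "l \<le> k - 2" for l
  proof -
    define F G where "F x = (- 1) ^ l * (deriv ^^ l) f x" and "G x = (- 1) ^ l * (deriv ^^ l) g x" for x
    have FG: "0 \<le> F x" "0 \<le> G x" if "0 < x" for x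
      using f g l that by (auto simp: k_monotone_def F_def G_def)
    have anti: "antimono_on {0<..} F" "antimono_on {0<..} G"
      using f g l unfolding F_def G_def by (auto simp: k_monotone_def)
    have conv: "convex_on {0<..} F" "convex_on {0<..} G"
      using f g l unfolding F_def G_def by (auto simp: k_monotone_def)
    have eq: "(- 1) ^ l * (deriv ^^ l) h x = a * F x + b * G x" if "0 < x" for x
      using h[OF l that] by (simp add: F_def G_def algebra_simps)
    show "\<forall>x>0. 0 \<le> (- 1) ^ l * (deriv ^^ l) h x" using eq FG ab by simp
    show "antimono_on {0<..} (\<lambda>x. (- 1) ^ l * (deriv ^^ l) h x)"
      by (intro monotone_onI) (auto simp: eq ab intro!: add_mono mult_left_mono
          antimono_on_pos_le[OF anti(1)] antimono_on_pos_le[OF anti(2)])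
    have "convex_on {0<..} (\<lambda>x. a * F x + b * G x)"
      by (intro convex_on_add convex_on_cmul conv ab)
    then show "convex_on {0<..} (\<lambda>x. (- 1) ^ l * (deriv ^^ l) h x)"
      by (rule convex_on_cong_on) (simp add: eq)
  qed
  ultimately show ?thesis
    unfolding h_def[symmetric] by (auto simp: k_monotone_def intro: zero_less_one)
qed

section \<open>First-order conditions for the least squares estimator\<close>

definition empirical_mean :: "nat \<Rightarrow> (nat \<Rightarrow> real) \<Rightarrow> (real \<Rightarrow> real) \<Rightarrow> real" where
  "empirical_mean n x f = (\<Sum>i=1..n. f (x i)) / real n"

text \<open>
  A directional derivative at a minimum is nonnegative. The criterion is quadratic along each line,
  so the statement is elementary.
\<close>

lemma nonneg_if_quadratic_nonneg_near_0:
  fixes A B d :: real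
  assumes "0 < d" and "\<And>s. 0 < s \<Longrightarrow> s < d \<Longrightarrow> 0 \<le> s * A + s\<^sup>2 * B"
  shows "0 \<le> A"
proof (rule tendsto_lowerbound)
  show "((\<lambda>s. A + s * B) \<longlongrightarrow> A) (at_right 0)"
    by (auto intro!: tendsto_eq_intros)
  have "\<forall>\<^sub>F s in at_right 0. s \<in> {0<..<d}" using assms(1) by (rule eventually_at_right_real)
  then show "\<forall>\<^sub>F s in at_right 0. 0 \<le> A + s * B"
  proof eventually_elim
    case (elim s)
    then have "0 \<le> s * (A + s * B)" using assms(2)[of s] by (simp add: power2_eq_square algebra_simps)
    then show ?case using elim by (simp add: zero_le_mult_iff)
  qed
qed simp

lemma ls_criterion_lincomb:
  assumes f: "f \<in> L2" and g: "g \<in> L2"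
  shows "ls_criterion n x (\<lambda>y. a * f y + b * g y) =
    a\<^sup>2 / 2 * (LINT y:{0<..}|lborel. (f y)\<^sup>2) + a * b * (LINT y:{0<..}|lborel. f y * g y)
      + b\<^sup>2 / 2 * (LINT y:{0<..}|lborel. (g y)\<^sup>2)
      - a * empirical_mean n x f - b * empirical_mean n x g"
  unfolding ls_criterion_def L2_lincomb(2)[OF f g] empirical_mean_def
  by (simp add: sum.distrib sum_distrib_left[symmetric] algebra_simps add_divide_distrib)

text \<open>
  The minimization runs over a convex cone. Adding a small multiple of any \<open>h\<close> in the cone
  is admissible, which gives the inequality; shrinking \<open>g\<close> towards 0 is admissible as well, which
  reverses it for \<open>h = g\<close> and gives the equation.
\<close>

lemma lse_characterization:
  assumes g: "is_lse k n x g"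
  shows "g \<in> k_monotone k" "g \<in> L2"
    and "(LINT y:{0<..}|lborel. (g y)\<^sup>2) = empirical_mean n x g"
    and "h \<in> k_monotone k \<Longrightarrow> h \<in> L2 \<Longrightarrow> empirical_mean n x h \<le> (LINT y:{0<..}|lborel. g y * h y)"
proof -
  show gk: "g \<in> k_monotone k" and gL: "g \<in> L2"
    using g by (auto simp: is_lse_def is_arg_min_def)
  have min: "ls_criterion n x (\<lambda>y. 1 * g y + 0 * h y) \<le> ls_criterion n x (\<lambda>y. a * g y + b * h y)"
    if "h \<in> k_monotone k" "h \<in> L2" "0 \<le> a" "0 \<le> b" for h a b
    using g k_monotone_lincomb[OF gk that(1,3,4)] L2_lincomb(1)[OF gL that(2), of a b]
    unfolding is_lse_def is_arg_min_def by (auto simp: not_less)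
  define G where "G = (LINT y:{0<..}|lborel. (g y)\<^sup>2)"
  show "empirical_mean n x h \<le> (LINT y:{0<..}|lborel. g y * h y)"
    if h: "h \<in> k_monotone k" "h \<in> L2" for h
  proof -
    have "0 \<le> (LINT y:{0<..}|lborel. g y * h y) - empirical_mean n x h"
    proof (rule nonneg_if_quadratic_nonneg_near_0[of 1])
      fix s :: real assume "0 < s"
      then show "0 \<le> s * ((LINT y:{0<..}|lborel. g y * h y) - empirical_mean n x h)
          + s\<^sup>2 * ((LINT y:{0<..}|lborel. (h y)\<^sup>2) / 2)"
        using min[OF h, of 1 s] unfolding ls_criterion_lincomb[OF gL h(2)]
        by (simp add: algebra_simps)
    qed simp
    then show ?thesis by simp
  qed
  from this[OF gk gL] have "empirical_mean n x g \<le> G" by (simp add: G_def power2_eq_square)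
  moreover have "0 \<le> empirical_mean n x g - G"
  proof (rule nonneg_if_quadratic_nonneg_near_0[of 1])
    fix s :: real assume "0 < s" "s < 1"
    then show "0 \<le> s * (empirical_mean n x g - G) + s\<^sup>2 * (G / 2)"
      using min[OF gk gL, of "1 - s" 0] unfolding ls_criterion_lincomb[OF gL gL] G_def[symmetric]
      by (simp add: power2_eq_square algebra_simps add_divide_distrib diff_divide_distrib)
  qed simp
  ultimately show "(LINT y:{0<..}|lborel. (g y)\<^sup>2) = empirical_mean n x g" by (simp add: G_def)
qed

text \<open>
  The basic inequality. Expanding the square, the equation of the characterization replaces the
  square integral of \<open>g\<close> by an empirical mean, and the inequality in the direction \<open>g0\<close> replaces
  one of the two inner products of \<open>g\<close> and \<open>g0\<close>. What is left are two differences between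
  empirical and true means.
\<close>

lemma lse_error_le:
  assumes g: "is_lse k n x g" and g0: "g0 \<in> k_monotone k" "g0 \<in> L2"
  shows "(L2_norm (\<lambda>y. g y - g0 y))\<^sup>2 \<le>
    (empirical_mean n x g - (LINT y:{0<..}|lborel. g y * g0 y))
    + ((LINT y:{0<..}|lborel. (g0 y)\<^sup>2) - empirical_mean n x g0)"
  unfolding L2_norm_square
  using L2_diff(2)[OF lse_characterization(2)[OF g] g0(2)] lse_characterization(3)[OF g]
    lse_characterization(4)[OF g g0] by simp

text \<open>
  The squared norm is the empirical mean of \<open>g\<close>, which is at most the norm times the empirical mean
  of \<open>x powr (- 1 / 2)\<close>; one factor of the norm cancels. This a priori bound puts the estimators
  for almost every sample below a fixed multiple of the weight.
\<close>

lemma lse_L2_norm_le: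
  assumes g: "is_lse k n x g" and x: "\<And>i. i \<ge> 1 \<Longrightarrow> 0 < x i"
  shows "L2_norm g \<le> empirical_mean n x (\<lambda>y. y powr (- 1 / 2))"
proof -
  note gk = lse_characterization(1)[OF g] and gL = lse_characterization(2)[OF g]
  have "(L2_norm g)\<^sup>2 = empirical_mean n x g"
    unfolding L2_norm_square by (rule lse_characterization(3)[OF g])
  also have "\<dots> \<le> (\<Sum>i=1..n. L2_norm g * x i powr (- 1 / 2)) / real n"
    unfolding empirical_mean_def
    by (intro divide_right_mono sum_mono decreasing_le_L2_norm gL k_monotone_nonneg[OF gk]
        k_monotone_antimono[OF gk] x) auto
  also have "\<dots> = L2_norm g * empirical_mean n x (\<lambda>y. y powr (- 1 / 2))"
    by (simp add: empirical_mean_def sum_distrib_left)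
  finally have "L2_norm g * L2_norm g \<le> L2_norm g * empirical_mean n x (\<lambda>y. y powr (- 1 / 2))"
    by (simp add: power2_eq_square)
  moreover have "0 \<le> empirical_mean n x (\<lambda>y. y powr (- 1 / 2))"
    unfolding empirical_mean_def by (intro divide_nonneg_nonneg sum_nonneg) auto
  ultimately show ?thesis using L2_norm_nonneg[of g]
    by (cases "L2_norm g = 0") (auto simp: mult_le_cancel_left)
qed

section \<open>A one-sided uniform law for decreasing functions\<close>

lemma ex_grid_cell:
  fixes q :: "nat \<Rightarrow> real"
  shows "q 0 < y \<Longrightarrow> y \<le> q m \<Longrightarrow> \<exists>i<m. q i < y \<and> y \<le> q (Suc i)"
proof (induction m)
  case (Suc m)
  then show ?case by (cases "y \<le> q m") (auto intro: less_SucI)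
qed simp

text \<open>
  A decreasing function below an envelope \<open>K * w\<close> is dominated by the envelope left of a grid,
  by its value at the left end of each grid cell, and by its last grid value on the right. Only the
  coefficients of this bound depend on \<open>f\<close>; the functions of \<open>y\<close> in it are fixed.
\<close>

lemma decreasing_le_grid_sum:
  fixes f q :: "_ \<Rightarrow> real"
  assumes nonneg: "\<And>y. 0 < y \<Longrightarrow> 0 \<le> f y" and anti: "antimono_on {0<..} f"
    and K: "\<And>y. 0 < y \<Longrightarrow> f y \<le> K * w y" and q: "\<And>i. 0 < q i"
    and Kw: "\<And>y. 0 < y \<Longrightarrow> 0 \<le> K * w y" and y: "0 < y"
  shows "f y \<le> K * (w y * of_bool (y \<le> q 0)) + (\<Sum>i<m. f (q i) * of_bool (q i < y \<and> y \<le> q (Suc i))) + f (q m)"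
proof -
  let ?S = "\<Sum>i<m. f (q i) * of_bool (q i < y \<and> y \<le> q (Suc i))"
  have S: "0 \<le> ?S" by (intro sum_nonneg mult_nonneg_nonneg nonneg q) auto
  have fm: "0 \<le> f (q m)" by (intro nonneg q)
  have w0: "0 \<le> K * (w y * of_bool (y \<le> q 0))" using Kw[OF y] by auto
  consider "y \<le> q 0" | "q m < y" | "q 0 < y" "y \<le> q m" by linarith
  then show ?thesis
  proof cases
    case 1
    then show ?thesis using K[OF y] S fm by simp
  next
    case 2
    then have "f y \<le> f (q m)" using q by (intro antimono_on_pos_le[OF anti]) auto
    then show ?thesis using S w0 by linarith
  next
    case 3
    then obtain i where i: "i < m" "q i < y" "y \<le> q (Suc i)" using ex_grid_cell by blast
    have "f y \<le> f (q i)" using q i by (intro antimono_on_pos_le[OF anti]) auto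
    also have "\<dots> = f (q i) * of_bool (q i < y \<and> y \<le> q (Suc i))" using i by simp
    also have "\<dots> \<le> ?S"
      by (rule member_le_sum[where f="\<lambda>i. f (q i) * of_bool (q i < y \<and> y \<le> q (Suc i))"])
        (use i nonneg q in auto)
    finally show ?thesis using fm w0 by linarith
  qed
qed

text \<open>
  The lower counterpart, with the values at the right ends of the cells. The factor
  \<open>of_bool (y \<le> q m)\<close> carries the disjointness of the cells through the induction.
\<close>

lemma grid_sum_le_decreasing:
  fixes f q :: "_ \<Rightarrow> real"
  assumes nonneg: "\<And>y. 0 < y \<Longrightarrow> 0 \<le> f y" and anti: "antimono_on {0<..} f"
    and q: "\<And>i. q i \<le> q (Suc i)" and y: "0 < y"
  shows "(\<Sum>i<m. f (q (Suc i)) * of_bool (q i < y \<and> y \<le> q (Suc i))) \<le> f y * of_bool (y \<le> q m)"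
proof (induction m)
  case 0
  then show ?case using nonneg[OF y] by simp
next
  case (Suc m)
  consider "y \<le> q m" | "q m < y" "y \<le> q (Suc m)" | "q (Suc m) < y" by linarith
  then show ?case
  proof cases
    case 1
    then show ?thesis using Suc q[of m] by simp
  next
    case 2
    then have "f (q (Suc m)) \<le> f y" using y by (intro antimono_on_pos_le[OF anti]) auto
    then show ?thesis using Suc 2 by simp
  next
    case 3
    then show ?thesis using Suc q[of m] by simp
  qed
qed

lemma empirical_mean_add:
  "empirical_mean n x (\<lambda>y. f y + g y) = empirical_mean n x f + empirical_mean n x g"
  by (simp add: empirical_mean_def sum.distrib add_divide_distrib)

lemma empirical_mean_cmult: "empirical_mean n x (\<lambda>y. c * f y) = c * empirical_mean n x f"
  by (simp add: empirical_mean_def sum_distrib_left)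

lemma empirical_mean_sum:
  "empirical_mean n x (\<lambda>y. \<Sum>j\<in>J. f j y) = (\<Sum>j\<in>J. empirical_mean n x (f j))"
  unfolding empirical_mean_def by (subst sum.swap) (simp add: sum_divide_distrib)

lemma empirical_mean_const_le: "0 \<le> c \<Longrightarrow> empirical_mean n x (\<lambda>_. c) \<le> c"
  by (cases "n = 0") (simp_all add: empirical_mean_def)

lemma empirical_mean_mono:
  assumes "\<And>i. i \<ge> 1 \<Longrightarrow> 0 < x i" and "\<And>y. 0 < y \<Longrightarrow> f y \<le> g y"
  shows "empirical_mean n x f \<le> empirical_mean n x g"
  unfolding empirical_mean_def using assms by (intro divide_right_mono sum_mono) auto

lemma set_integrable_of_bool_mult:
  fixes f :: "real \<Rightarrow> real"
  assumes f: "set_integrable lborel A f" and [measurable]: "Measurable.pred borel P"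
  shows "set_integrable lborel A (\<lambda>y. of_bool (P y) * f y)"
proof -
  have "integrable lborel (\<lambda>y. indicator {y. P y} y *\<^sub>R (indicator A y *\<^sub>R f y))"
    by (rule integrable_mult_indicator[OF _ f[unfolded set_integrable_def]]) simp
  also have "(\<lambda>y. indicator {y. P y} y *\<^sub>R (indicator A y *\<^sub>R f y)) = (\<lambda>y. indicator A y *\<^sub>R (of_bool (P y) * f y))"
    by (auto simp: indicator_def)
  finally show ?thesis unfolding set_integrable_def .
qed

lemma set_integral_sum_real:
  fixes f :: "'i \<Rightarrow> 'a \<Rightarrow> real"
  assumes "\<And>i. i \<in> I \<Longrightarrow> set_integrable M A (f i)"
  shows "set_integrable M A (\<lambda>x. \<Sum>i\<in>I. f i x)"
    and "(LINT x:A|M. \<Sum>i\<in>I. f i x) = (\<Sum>i\<in>I. LINT x:A|M. f i x)"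
  using assms unfolding set_integrable_def set_lebesgue_integral_def
  by (simp_all add: sum_distrib_left)

lemma set_integral_interval_le:
  fixes g :: "real \<Rightarrow> real"
  assumes g: "set_integrable lborel {0<..} g" and ab: "0 < a" "a \<le> b"
    and le: "\<And>y. a < y \<Longrightarrow> y \<le> b \<Longrightarrow> g y \<le> c"
  shows "(LINT y:{0<..}|lborel. of_bool (a < y \<and> y \<le> b) * g y) \<le> (b - a) * c"
proof -
  have "(LINT y:{0<..}|lborel. of_bool (a < y \<and> y \<le> b) * g y)
      \<le> (\<integral>y. indicator {a<..b} y * c \<partial>lborel)"
    unfolding set_lebesgue_integral_def
  proof (rule integral_mono)
    show "integrable lborel (\<lambda>y. indicator {0<..} y *\<^sub>R (of_bool (a < y \<and> y \<le> b) * g y))"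
      using set_integrable_of_bool_mult[OF g, of "\<lambda>y. a < y \<and> y \<le> b"]
      by (simp add: set_integrable_def)
    show "integrable lborel (\<lambda>y. indicator {a<..b} y * c)"
      using ab by (intro integrable_mult_left) (auto intro!: integrable_real_indicator)
    show "indicator {0<..} y *\<^sub>R (of_bool (a < y \<and> y \<le> b) * g y) \<le> indicator {a<..b} y * c" for y
      using le[of y] ab by (auto simp: indicator_def)
  qed
  also have "\<dots> = (b - a) * c" using ab by simp
  finally show ?thesis .
qed

lemma set_integral_near_0_tendsto_0:
  fixes h :: "real \<Rightarrow> real"
  assumes h: "set_integrable lborel {0<..} h"
  shows "(\<lambda>j. LINT y:{0<..}|lborel. of_bool (y \<le> 1 / real (Suc j)) * h y) \<longlonglongrightarrow> 0"
proof -
  have "(\<lambda>j. \<integral>y. indicator {0<..} y *\<^sub>R (of_bool (y \<le> 1 / real (Suc j)) * h y) \<partial>lborel) \<longlonglongrightarrow> (\<integral>y. (0::real) \<partial>(lborel :: real measure))"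
  proof (rule integral_dominated_convergence[where w="\<lambda>y. \<bar>indicator {0<..} y *\<^sub>R h y\<bar>"])
    show "integrable lborel (\<lambda>y. \<bar>indicator {0<..} y *\<^sub>R h y\<bar>)"
      using h unfolding set_integrable_def by (rule integrable_abs)
    show "AE y in lborel. (\<lambda>j. indicator {0<..} y *\<^sub>R (of_bool (y \<le> 1 / real (Suc j)) * h y)) \<longlonglongrightarrow> 0"
    proof (intro AE_I2 tendsto_eventually)
      fix y :: real
      show "\<forall>\<^sub>F j in sequentially. indicator {0<..} y *\<^sub>R (of_bool (y \<le> 1 / real (Suc j)) * h y) = 0"
      proof (cases "0 < y")
        case True
        then have "\<forall>\<^sub>F j in sequentially. inverse (real (Suc j)) < y"
          by (intro order_tendstoD(2)[OF LIMSEQ_inverse_real_of_nat])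
        then show ?thesis by eventually_elim (simp add: inverse_eq_divide not_le[symmetric])
      qed simp
    qed
    show "(\<lambda>y. indicator {0<..} y *\<^sub>R (of_bool (y \<le> 1 / real (Suc j)) * h y)) \<in> borel_measurable lborel" for j
      using set_integrable_of_bool_mult[OF h, of "\<lambda>y. y \<le> 1 / real (Suc j)"]
      unfolding set_integrable_def by (intro borel_measurable_integrable) auto
  qed (auto intro!: AE_I2 simp: indicator_def)
  then show ?thesis by (simp add: set_lebesgue_integral_def)
qed

text \<open>
  Squeezing \<open>f\<close> between its two grid functions bounds the excess of the empirical over the true
  mean by four terms that do not depend on \<open>f\<close>. Left of the first grid point \<open>\<delta>\<close> the
  envelope has small mass for small \<open>\<delta>\<close>. Right of the last grid point \<open>f\<close> itself is small. On the
  cells the deviations of finitely many empirical frequencies enter with weights at most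
  \<open>K * w \<delta>\<close>; and the gap between the two grid functions telescopes, so that it costs at
  most \<open>K * w \<delta>\<close> times the largest mass of a cell, which is at most \<open>\<eta> * g0 \<delta>\<close> for cells of
  length \<open>\<eta>\<close>. The grid is rational, so that the hypotheses are countably many limits and can hold
  simultaneously almost surely.
\<close>

lemma empirical_mean_uniform_upper_bound:
  fixes x :: "nat \<Rightarrow> real" and g0 :: "real \<Rightarrow> real"
  defines "w \<equiv> \<lambda>y::real. y powr (- 1 / 2)"
  assumes x: "\<And>i. i \<ge> 1 \<Longrightarrow> 0 < x i"
    and g0_nonneg: "\<And>y. 0 < y \<Longrightarrow> 0 \<le> g0 y" and g0_anti: "antimono_on {0<..} g0"
    and g0_int: "set_integrable lborel {0<..} g0"
    and wg0_int: "set_integrable lborel {0<..} (\<lambda>y. w y * g0 y)"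
    and near0: "\<And>j::nat. (\<lambda>n. empirical_mean n x (\<lambda>y. w y * of_bool (y \<le> 1 / real (Suc j))))
        \<longlonglongrightarrow> (LINT y:{0<..}|lborel. of_bool (y \<le> 1 / real (Suc j)) * (w y * g0 y))"
    and cells: "\<And>a b. a \<in> \<rat> \<Longrightarrow> b \<in> \<rat> \<Longrightarrow>
        (\<lambda>n. empirical_mean n x (\<lambda>y. of_bool (a < y \<and> y \<le> b)))
        \<longlonglongrightarrow> (LINT y:{0<..}|lborel. of_bool (a < y \<and> y \<le> b) * g0 y)"
    and K: "0 \<le> K" and \<epsilon>: "0 < \<epsilon>"
  shows "\<forall>\<^sub>F n in sequentially. \<forall>f. (\<forall>y>0. 0 \<le> f y) \<longrightarrow> antimono_on {0<..} f \<longrightarrow>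
      (\<forall>y>0. f y \<le> K * w y) \<longrightarrow> set_integrable lborel {0<..} (\<lambda>y. f y * g0 y) \<longrightarrow>
      empirical_mean n x f \<le> (LINT y:{0<..}|lborel. f y * g0 y) + \<epsilon>"
proof -
  define E where "E j = (LINT y:{0<..}|lborel. of_bool (y \<le> 1 / real (Suc j)) * (w y * g0 y))" for j :: nat
  have "(\<lambda>j. K * E j) \<longlonglongrightarrow> K * 0"
    unfolding E_def by (intro tendsto_mult tendsto_const set_integral_near_0_tendsto_0 wg0_int)
  then have "\<forall>\<^sub>F j in sequentially. K * E j < \<epsilon> / 4"
    using \<epsilon> by (intro order_tendstoD(2)) auto
  then obtain j where j: "K * E j < \<epsilon> / 4" by (auto simp: eventually_sequentially)
  define \<delta> where "\<delta> = 1 / real (Suc j)"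
  have \<delta>: "0 < \<delta>" "\<delta> \<in> \<rat>" unfolding \<delta>_def by auto
  \<comment> \<open>bounds all grid values of every \<open>f\<close> below the envelope\<close>
  define B where "B = K * w \<delta>"
  have B: "0 \<le> B" unfolding B_def w_def using K by simp
  obtain l :: nat where l: "4 / \<epsilon> * (g0 \<delta> * B) < real l" using reals_Archimedean2 by blast
  define \<eta> where "\<eta> = 1 / real (Suc l)"
  have \<eta>: "0 < \<eta>" "\<eta> \<in> \<rat>" unfolding \<eta>_def by auto
  have \<eta>_small: "\<eta> * g0 \<delta> * B < \<epsilon> / 4"
  proof -
    have "4 / \<epsilon> * (g0 \<delta> * B) < real (Suc l)" using l by simp
    then show ?thesis using \<epsilon> by (simp add: \<eta>_def field_simps)
  qed
  define q where "q i = \<delta> + real i * \<eta>" for i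
  have q: "0 < q i" "q i \<in> \<rat>" "q i \<le> q (Suc i)" "\<delta> \<le> q i" "q (Suc i) - q i = \<eta>" for i
    unfolding q_def using \<delta> \<eta> by (auto simp: algebra_simps add_pos_nonneg)
  have q0: "q 0 = \<delta>" by (simp add: q_def)
  have "(\<lambda>m. K * w (q m)) \<longlonglongrightarrow> K * 0"
  proof (intro tendsto_mult tendsto_const)
    have "filterlim q at_top sequentially"
      unfolding q_def
      by (intro filterlim_tendsto_add_at_top[OF tendsto_const]
          filterlim_at_top_mult_tendsto_pos[OF tendsto_const \<eta>(1)] filterlim_real_sequentially)
    then show "(\<lambda>m. w (q m)) \<longlonglongrightarrow> 0" unfolding w_def by (intro tendsto_neg_powr) auto
  qed
  then have "\<forall>\<^sub>F m in sequentially. K * w (q m) < \<epsilon> / 4"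
    using \<epsilon> by (intro order_tendstoD(2)) auto
  then obtain m where m: "K * w (q m) < \<epsilon> / 4" by (auto simp: eventually_sequentially)
  define C where "C i y = (of_bool (q i < y \<and> y \<le> q (Suc i)) :: real)" for i y
  define p where "p i = (LINT y:{0<..}|lborel. C i y * g0 y)" for i
  have Cg0_int: "set_integrable lborel {0<..} (\<lambda>y. C i y * g0 y)" for i
    unfolding C_def by (intro set_integrable_of_bool_mult g0_int) measurable
  have p: "0 \<le> p i" "p i \<le> \<eta> * g0 \<delta>" for i
  proof -
    show "0 \<le> p i" unfolding p_def set_lebesgue_integral_def C_def
      by (intro Bochner_Integration.integral_nonneg) (auto simp: indicator_def g0_nonneg)
    have "p i \<le> (q (Suc i) - q i) * g0 \<delta>"
      unfolding p_def C_def
    proof (rule set_integral_interval_le[OF g0_int q(1) q(3)])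
      show "g0 y \<le> g0 \<delta>" if "q i < y" for y
        using that q(4)[of i] \<delta> by (intro antimono_on_pos_le[OF g0_anti]) auto
    qed
    then show "p i \<le> \<eta> * g0 \<delta>" by (simp add: q)
  qed
  have "(\<lambda>n. K * empirical_mean n x (\<lambda>y. w y * of_bool (y \<le> \<delta>))) \<longlonglongrightarrow> K * E j"
    unfolding E_def \<delta>_def by (intro tendsto_mult tendsto_const near0)
  then have ev1: "\<forall>\<^sub>F n in sequentially. K * empirical_mean n x (\<lambda>y. w y * of_bool (y \<le> \<delta>)) < \<epsilon> / 4"
    using j by (rule order_tendstoD(2))
  have "(\<lambda>n. B * (\<Sum>i<m. \<bar>empirical_mean n x (C i) - p i\<bar>)) \<longlonglongrightarrow> B * (\<Sum>i<m. \<bar>p i - p i\<bar>)"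
    unfolding p_def C_def
    by (intro tendsto_mult tendsto_const tendsto_sum tendsto_rabs tendsto_diff cells q)
  then have ev2: "\<forall>\<^sub>F n in sequentially. B * (\<Sum>i<m. \<bar>empirical_mean n x (C i) - p i\<bar>) < \<epsilon> / 4"
    using \<epsilon> by (intro order_tendstoD(2)) auto
  from ev1 ev2 show ?thesis
  proof (eventually_elim, intro allI impI)
    fix n f
    assume n1: "K * empirical_mean n x (\<lambda>y. w y * of_bool (y \<le> \<delta>)) < \<epsilon> / 4"
      and n2: "B * (\<Sum>i<m. \<bar>empirical_mean n x (C i) - p i\<bar>) < \<epsilon> / 4"
      and f0: "\<forall>y>0. 0 \<le> f y" and f_anti: "antimono_on {0<..} f"
      and fK: "\<forall>y>0. f y \<le> K * w y" and fint: "set_integrable lborel {0<..} (\<lambda>y. f y * g0 y)"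
    have fq: "0 \<le> f (q i)" "f (q i) \<le> B" "f (q (Suc i)) \<le> f (q i)" for i
    proof -
      show "0 \<le> f (q i)" using f0 q by simp
      have "f (q i) \<le> f \<delta>" using q \<delta> by (intro antimono_on_pos_le[OF f_anti])
      then show "f (q i) \<le> B" using fK \<delta> by (auto simp: B_def intro: order_trans)
      show "f (q (Suc i)) \<le> f (q i)" using q by (intro antimono_on_pos_le[OF f_anti])
    qed
    have "empirical_mean n x f \<le> empirical_mean n x (\<lambda>y. K * (w y * of_bool (y \<le> \<delta>))
        + (\<Sum>i<m. f (q i) * C i y) + f (q m))"
      unfolding C_def q0[symmetric]
      by (intro empirical_mean_mono x decreasing_le_grid_sum f_anti q)
        (use f0 fK K in \<open>auto simp: w_def\<close>)
    also have "\<dots> = K * empirical_mean n x (\<lambda>y. w y * of_bool (y \<le> \<delta>))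
        + (\<Sum>i<m. f (q i) * empirical_mean n x (C i)) + empirical_mean n x (\<lambda>_. f (q m))"
      by (simp add: empirical_mean_add empirical_mean_cmult empirical_mean_sum)
    finally have upper: "empirical_mean n x f \<le> \<epsilon> / 4
        + (\<Sum>i<m. f (q i) * empirical_mean n x (C i)) + \<epsilon> / 4"
      using n1 m fK q empirical_mean_const_le[OF fq(1), of n x m] by (smt (verit))
    have "(\<Sum>i<m. f (q (Suc i)) * p i) = (LINT y:{0<..}|lborel. (\<Sum>i<m. f (q (Suc i)) * (C i y * g0 y)))"
      unfolding p_def by (subst set_integral_sum_real) (auto intro!: Cg0_int)
    also have "\<dots> \<le> (LINT y:{0<..}|lborel. f y * g0 y)"
    proof (rule set_integral_mono)
      show "set_integrable lborel {0<..} (\<lambda>y. \<Sum>i<m. f (q (Suc i)) * (C i y * g0 y))"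
        by (intro set_integral_sum_real set_integrable_mult_right Cg0_int)
      fix y :: real assume "y \<in> {0<..}"
      then have y: "0 < y" by simp
      have "(\<Sum>i<m. f (q (Suc i)) * C i y) \<le> f y * of_bool (y \<le> q m)"
        unfolding C_def using f0 by (intro grid_sum_le_decreasing f_anti q y) auto
      also have "\<dots> \<le> f y" using f0 y by auto
      finally have "(\<Sum>i<m. f (q (Suc i)) * C i y) * g0 y \<le> f y * g0 y"
        using g0_nonneg[OF y] by (intro mult_right_mono)
      then show "(\<Sum>i<m. f (q (Suc i)) * (C i y * g0 y)) \<le> f y * g0 y"
        by (simp add: sum_distrib_right mult.assoc)
    qed (rule fint)
    finally have lower: "(\<Sum>i<m. f (q (Suc i)) * p i) \<le> (LINT y:{0<..}|lborel. f y * g0 y)" .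
    \<comment> \<open>separate the random error of the frequencies from the deterministic gap between
        the upper and lower grid functions\<close>
    have "(\<Sum>i<m. f (q i) * empirical_mean n x (C i)) - (\<Sum>i<m. f (q (Suc i)) * p i)
        = (\<Sum>i<m. f (q i) * (empirical_mean n x (C i) - p i)) + (\<Sum>i<m. (f (q i) - f (q (Suc i))) * p i)"
      by (simp add: sum_subtractf[symmetric] sum.distrib[symmetric] algebra_simps)
    also have "\<dots> \<le> (\<Sum>i<m. B * \<bar>empirical_mean n x (C i) - p i\<bar>) + (\<Sum>i<m. (f (q i) - f (q (Suc i))) * (\<eta> * g0 \<delta>))"
    proof (intro add_mono sum_mono)
      fix i
      have "f (q i) * (empirical_mean n x (C i) - p i) \<le> f (q i) * \<bar>empirical_mean n x (C i) - p i\<bar>"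
        using fq by (intro mult_left_mono) auto
      also have "\<dots> \<le> B * \<bar>empirical_mean n x (C i) - p i\<bar>" using fq by (intro mult_right_mono) auto
      finally show "f (q i) * (empirical_mean n x (C i) - p i) \<le> B * \<bar>empirical_mean n x (C i) - p i\<bar>" .
      show "(f (q i) - f (q (Suc i))) * p i \<le> (f (q i) - f (q (Suc i))) * (\<eta> * g0 \<delta>)"
        using fq p by (intro mult_left_mono) auto
    qed
    also have "\<dots> = B * (\<Sum>i<m. \<bar>empirical_mean n x (C i) - p i\<bar>) + (f (q 0) - f (q m)) * (\<eta> * g0 \<delta>)"
      by (simp add: sum_distrib_left[symmetric] sum_distrib_right[symmetric] sum_lessThan_telescope'[of "\<lambda>i. f (q i)" m])
    also have "\<dots> \<le> \<epsilon> / 4 + B * (\<eta> * g0 \<delta>)"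
      using n2 fq(1)[of m] fq(2)[of 0] \<eta> g0_nonneg[OF \<delta>(1)]
      by (intro add_mono mult_right_mono) auto
    also have "\<dots> \<le> \<epsilon> / 4 + \<epsilon> / 4" using \<eta>_small by (simp add: mult_ac)
    finally show "empirical_mean n x f \<le> (LINT y:{0<..}|lborel. f y * g0 y) + \<epsilon>"
      using upper lower by linarith
  qed
qed

section \<open>From square-mean to uniform convergence\<close>

text \<open>
  The slope of a convex function to the right of \<open>a\<close> is at least its slope between \<open>b\<close> and \<open>a\<close>,
  which nonnegativity bounds from below in terms of the single value \<open>g b\<close>.
\<close>

lemma convex_nonneg_decrease_le:
  fixes g :: "real \<Rightarrow> real"
  assumes conv: "convex_on {0<..} g" and nonneg: "\<And>y. 0 < y \<Longrightarrow> 0 \<le> g y"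
    and b: "0 < b" "b < a" and xy: "a \<le> x" "x < y"
  shows "g x - g y \<le> g b / (a - b) * (y - x)"
proof -
  have "(g b - g x) / (b - x) \<le> (g b - g y) / (b - y)" "(g b - g y) / (b - y) \<le> (g x - g y) / (x - y)"
    using convex_on_slope_le[OF conv, of b y x] b xy by auto
  then have "(g b - g x) / (b - x) \<le> (g x - g y) / (x - y)" by simp
  then have "(g x - g y) / (y - x) \<le> (g b - g x) / (x - b)"
    using minus_divide_right[of "g b - g x" "x - b"] minus_divide_right[of "g x - g y" "y - x"] by simp
  also have "\<dots> \<le> g b / (a - b)"
    using nonneg[of x] nonneg[of b] b xy by (intro frac_le) auto
  finally show ?thesis using xy by (simp add: field_simps)
qed

text \<open>
  If \<open>g x\<close> exceeds \<open>g0 x\<close> by \<open>\<epsilon>\<close>, then \<open>g\<close> is at least as large to the left of \<open>x\<close> while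
  the Lipschitz function \<open>g0\<close> grows by at most \<open>\<epsilon> / 2\<close> over a length \<open>\<eta>\<close>, so the
  difference stays above \<open>\<epsilon> / 2\<close> there and has square mass at least \<open>\<eta> * (\<epsilon> / 2)\<^sup>2\<close>. If
  \<open>g x\<close> is too small, the same happens to the right of \<open>x\<close>. Staying \<open>c / 2\<close> away from 0 makes
  \<open>\<eta>\<close> independent of \<open>x\<close> and of \<open>g\<close>.
\<close>

lemma uniform_close_if_L2_close:
  fixes g0 :: "real \<Rightarrow> real"
  assumes conv: "convex_on {0<..} g0" and nonneg: "\<And>y. 0 < y \<Longrightarrow> 0 \<le> g0 y"
    and c: "0 < c" and \<epsilon>: "0 < \<epsilon>"
  obtains \<rho> where "0 < \<rho>"
    and "\<And>g x. antimono_on {0<..} g \<Longrightarrow> (\<lambda>y. g y - g0 y) \<in> L2 \<Longrightarrow>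
      L2_norm (\<lambda>y. g y - g0 y) < \<rho> \<Longrightarrow> c \<le> x \<Longrightarrow> \<bar>g x - g0 x\<bar> \<le> \<epsilon>"
proof -
  define L where "L = g0 (c / 4) / (c / 2 - c / 4)"
  have L: "0 \<le> L" unfolding L_def using c nonneg by (intro divide_nonneg_nonneg) auto
  have lip: "g0 x - g0 y \<le> L * (y - x)" if "c / 2 \<le> x" "x < y" for x y
    unfolding L_def using that c by (intro convex_nonneg_decrease_le[OF conv nonneg]) auto
  define \<eta> where "\<eta> = min (c / 2) (\<epsilon> / (2 * (L + 1)))"
  have "0 < \<eta>" unfolding \<eta>_def using c \<epsilon> L by simp
  moreover have "\<eta> \<le> c / 2" unfolding \<eta>_def by (rule min.cobounded1)
  ultimately have \<eta>: "0 < \<eta>" "\<eta> \<le> c / 2" by simp_all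
  have "(L + 1) * \<eta> \<le> (L + 1) * (\<epsilon> / (2 * (L + 1)))"
    unfolding \<eta>_def using L by (intro mult_left_mono) auto
  also have "\<dots> = \<epsilon> / 2" using L by (simp add: field_simps)
  finally have L\<eta>: "L * \<eta> \<le> \<epsilon> / 2" using \<eta> by (simp add: algebra_simps)
  have lip': "g0 x - g0 y \<le> \<epsilon> / 2" if "c / 2 \<le> x" "x < y" "y - x \<le> \<eta>" for x y
  proof -
    have "L * (y - x) \<le> L * \<eta>" using that L by (intro mult_left_mono) auto
    then show ?thesis using lip[OF that(1,2)] L\<eta> by linarith
  qed
  define \<rho> where "\<rho> = sqrt (\<eta> * (\<epsilon> / 2)\<^sup>2)"
  show thesis
  proof
    show "0 < \<rho>" unfolding \<rho>_def using \<eta> \<epsilon> by simp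
    fix g x
    assume anti: "antimono_on {0<..} g" and L2: "(\<lambda>y. g y - g0 y) \<in> L2"
      and close: "L2_norm (\<lambda>y. g y - g0 y) < \<rho>" and x: "c \<le> x"
    have small: "(LINT y:{0<..}|lborel. (g y - g0 y)\<^sup>2) < \<eta> * (\<epsilon> / 2)\<^sup>2"
      using close unfolding \<rho>_def L2_norm_def by simp
    show "\<bar>g x - g0 x\<bar> \<le> \<epsilon>"
    proof (rule ccontr)
      assume "\<not> \<bar>g x - g0 x\<bar> \<le> \<epsilon>"
      then consider "g x > g0 x + \<epsilon>" | "g x < g0 x - \<epsilon>" by linarith
      then have "\<eta> * (\<epsilon> / 2)\<^sup>2 \<le> (LINT y:{0<..}|lborel. (g y - g0 y)\<^sup>2)"
      proof cases
        case 1
        have "(x - (x - \<eta>)) * (\<epsilon> / 2)\<^sup>2 \<le> (LINT y:{0<..}|lborel. (g y - g0 y)\<^sup>2)"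
        proof (rule square_integral_ge_on_interval[OF L2])
          fix y assume y: "x - \<eta> < y" "y < x"
          have "g x \<le> g y" using y x \<eta> c by (intro antimono_on_pos_le[OF anti]) auto
          moreover have "g0 y - g0 x \<le> \<epsilon> / 2" using y x \<eta> by (intro lip') auto
          ultimately show "\<epsilon> / 2 \<le> \<bar>g y - g0 y\<bar>" using 1 by linarith
        qed (use x \<eta> \<epsilon> c in auto)
        then show ?thesis by simp
      next
        case 2
        have "((x + \<eta>) - x) * (\<epsilon> / 2)\<^sup>2 \<le> (LINT y:{0<..}|lborel. (g y - g0 y)\<^sup>2)"
        proof (rule square_integral_ge_on_interval[OF L2])
          fix y assume y: "x < y" "y < x + \<eta>"
          have "g y \<le> g x" using y x c by (intro antimono_on_pos_le[OF anti]) auto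
          moreover have "g0 x - g0 y \<le> \<epsilon> / 2" using y x c by (intro lip') auto
          ultimately show "\<epsilon> / 2 \<le> \<bar>g y - g0 y\<bar>" using 2 by linarith
        qed (use x \<eta> \<epsilon> c in auto)
        then show ?thesis by simp
      qed
      with small show False by simp
    qed
  qed
qed

section \<open>Consistency\<close>

text \<open>
  The finite weighted integral \<open>J\<close> forces \<open>g x \<le> J * x powr (- 1 / 2)\<close> by monotonicity, so
  \<open>g\<^sup>2\<close> is dominated by \<open>J\<close> times the integrable product of the weight and \<open>g\<close>. In this way the
  moment condition puts the true density into the class over which the criterion is minimized.
\<close>

lemma decreasing_in_L2:
  fixes g :: "real \<Rightarrow> real"
  assumes nonneg: "\<And>y. 0 < y \<Longrightarrow> 0 \<le> g y" and anti: "antimono_on {0<..} g"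
    and int: "set_integrable lborel {0<..} (\<lambda>y. y powr (- 1 / 2) * g y)"
    and meas: "set_borel_measurable lborel {0<..} g"
  shows "g \<in> L2"
proof -
  define w where "w y = y powr (- 1 / 2)" for y :: real
  define J where "J = (LINT y:{0<..}|lborel. w y * g y)"
  have wint: "set_integrable lborel {0<..} (\<lambda>y. w y * g y)" using int by (simp add: w_def)
  have bound: "g x \<le> J * w x" if x: "0 < x" for x
  proof -
    have "x * (w x * g x) = (\<integral>y. indicator {0<..x} y * (w x * g x) \<partial>lborel)" using x by simp
    also have "\<dots> \<le> J"
      unfolding J_def set_lebesgue_integral_def
    proof (rule integral_mono)
      show "integrable lborel (\<lambda>y. indicator {0<..x} y * (w x * g x))"
        using x by (intro integrable_mult_left) (auto intro!: integrable_real_indicator)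
      show "integrable lborel (\<lambda>y. indicator {0<..} y *\<^sub>R (w y * g y))"
        using wint by (simp add: set_integrable_def)
      fix y
      have "w x * g x \<le> w y * g y" if "0 < y" "y \<le> x"
      proof (rule mult_mono)
        show "w x \<le> w y" unfolding w_def using that by (intro powr_mono2') auto
        show "g x \<le> g y" using that by (intro antimono_on_pos_le[OF anti])
      qed (use nonneg x in \<open>auto simp: w_def\<close>)
      then show "indicator {0<..x} y * (w x * g x) \<le> indicator {0<..} y *\<^sub>R (w y * g y)"
        using nonneg[of y] by (auto simp: indicator_def w_def)
    qed
    finally have le: "x * (w x * g x) \<le> J" .
    have "w x * w x = 1 / x"
      using x powr_add[of x "- 1 / 2" "- 1 / 2"] by (simp add: w_def powr_minus_divide)
    then have one: "w x * (x * w x) = 1" using x by (simp add: field_simps)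
    have "g x = (w x * (x * w x)) * g x" by (simp only: one mult_1_left)
    also have "\<dots> = (x * (w x * g x)) * w x" by (simp only: mult_ac)
    also have "\<dots> \<le> J * w x" using le by (rule mult_right_mono) (simp add: w_def)
    finally show ?thesis .
  qed
  have "set_integrable lborel {0<..} (\<lambda>y. (g y)\<^sup>2)"
  proof (rule set_integrable_bound)
    show "set_integrable lborel {0<..} (\<lambda>y. J * (w y * g y))" using wint by simp
    have "(\<lambda>y. (indicator {0<..} y *\<^sub>R g y)\<^sup>2) \<in> borel_measurable lborel"
      using meas unfolding set_borel_measurable_def by (rule borel_measurable_power)
    also have "(\<lambda>y. (indicator {0<..} y *\<^sub>R g y)\<^sup>2) = (\<lambda>y. indicator {0<..} y *\<^sub>R (g y)\<^sup>2)"
      by (auto simp: indicator_def)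
    finally show "set_borel_measurable lborel {0<..} (\<lambda>y. (g y)\<^sup>2)"
      unfolding set_borel_measurable_def .
    have "(g y)\<^sup>2 \<le> \<bar>J * (w y * g y)\<bar>" if "0 < y" for y
    proof -
      have "g y * g y \<le> (J * w y) * g y" using bound nonneg that by (intro mult_right_mono)
      then show ?thesis by (simp add: power2_eq_square mult.assoc)
    qed
    then show "AE y in lborel. y \<in> {0<..} \<longrightarrow> norm ((g y)\<^sup>2) \<le> norm (J * (w y * g y))" by simp
  qed
  then show ?thesis using meas by (simp add: L2_def)
qed

text \<open>
  Identifies the Stieltjes measure of the moment condition with the law of the observations,
  through the uniqueness of a distribution with given distribution function.
\<close>

lemma interval_measure_distribution_function:
  fixes g0 :: "real \<Rightarrow> real"
  defines "D \<equiv> density lborel (\<lambda>x. ennreal (indicator {0<..} x * g0 x))"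
  assumes g0: "density_on_pos g0" and D: "prob_space D"
  shows "interval_measure (distribution_function g0) = D"
proof -
  have nonneg: "0 \<le> g0 x" if "0 < x" for x using g0 that by (simp add: density_on_pos_def)
  have int: "set_integrable lborel {0<..} g0" using g0 by (simp add: density_on_pos_def)
  have meas [measurable]: "(\<lambda>x. indicator {0<..} x * g0 x) \<in> borel_measurable borel"
    using borel_measurable_integrable[OF int[unfolded set_integrable_def]] by simp
  interpret D: real_distribution D
    by (intro real_distribution.intro D real_distribution_axioms.intro) (simp_all add: D_def)
  have "measure D {..x} = distribution_function g0 x" for x
  proof -
    have int': "integrable lborel (\<lambda>y. indicator {0<..x} y *\<^sub>R g0 y)"
      unfolding set_integrable_def[symmetric] by (rule set_integrable_subset[OF int]) auto
    have "emeasure D {..x} = (\<integral>\<^sup>+y. ennreal (indicator {0<..} y * g0 y) * indicator {..x} y \<partial>lborel)"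
      unfolding D_def by (rule emeasure_density) auto
    also have "\<dots> = (\<integral>\<^sup>+y. ennreal (indicator {0<..x} y *\<^sub>R g0 y) \<partial>lborel)"
      by (intro nn_integral_cong) (auto simp: indicator_def)
    also have "\<dots> = ennreal (distribution_function g0 x)"
      unfolding distribution_function_def set_lebesgue_integral_def
      by (rule nn_integral_eq_integral[OF int']) (auto simp: indicator_def nonneg)
    finally have "measure D {..x} = enn2real (ennreal (distribution_function g0 x))"
      by (simp add: measure_def)
    moreover have "0 \<le> distribution_function g0 x"
      unfolding distribution_function_def set_lebesgue_integral_def
      by (intro Bochner_Integration.integral_nonneg) (auto simp: indicator_def nonneg)
    ultimately show ?thesis by simp
  qed
  then have cdf: "cdf D = distribution_function g0" by (simp add: cdf_def fun_eq_iff)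
  show ?thesis
  proof (rule cdf_unique)
    show "real_distribution (interval_measure (distribution_function g0))"
      unfolding cdf[symmetric]
      by (intro real_distribution_interval_measure D.cdf_nondecreasing D.cdf_is_right_cont
          D.cdf_lim_at_bot D.cdf_lim_at_top_prob)
    show "cdf (interval_measure (distribution_function g0)) = cdf D"
      unfolding cdf[symmetric]
      by (intro cdf_interval_measure D.cdf_nondecreasing D.cdf_is_right_cont D.cdf_lim_at_bot)
  qed (rule D.real_distribution_axioms)
qed

context prob_space
begin

lemma AE_pos_of_density_on_pos:
  assumes "distributed M lborel X (\<lambda>x. ennreal (indicator {0<..} x * g x))"
  shows "AE \<omega> in M. 0 < X \<omega>"
proof -
  have "AE x in density lborel (\<lambda>x. ennreal (indicator {0<..} x * g x)). 0 < x"
    using assms by (subst AE_density) (auto simp: distributed_def indicator_def intro!: AE_I2)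
  then have "AE x in distr M lborel X. 0 < x" unfolding distributed_distr_eq_density[OF assms] .
  then show ?thesis by (rule AE_distrD[rotated]) (use assms in \<open>simp add: distributed_def\<close>)
qed

text \<open>
  The strong law for functions of the observations. Only values on the half-line are controlled, so
  \<open>\<phi>\<close> is replaced by its restriction, which almost surely does not change the averages.
\<close>

lemma AE_empirical_mean_tendsto:
  fixes \<phi> g :: "real \<Rightarrow> real"
  assumes indep: "indep_vars (\<lambda>_. borel) X {1..}"
    and dist: "\<And>i. i \<ge> 1 \<Longrightarrow> distributed M lborel (X i) (\<lambda>x. ennreal (indicator {0<..} x * g x))"
    and g: "\<And>x. 0 < x \<Longrightarrow> 0 \<le> g x"
    and \<phi>: "set_borel_measurable lborel {0<..} \<phi>" "\<And>x. 0 < x \<Longrightarrow> 0 \<le> \<phi> x"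
    and int: "set_integrable lborel {0<..} (\<lambda>x. \<phi> x * g x)"
  shows "AE \<omega> in M. (\<lambda>n. empirical_mean n (\<lambda>i. X i \<omega>) \<phi>) \<longlonglongrightarrow> (LINT x:{0<..}|lborel. \<phi> x * g x)"
proof -
  define \<psi> where "\<psi> x = indicator {0<..} x * \<phi> x" for x
  have [measurable]: "\<psi> \<in> borel_measurable borel"
    using \<phi>(1) unfolding \<psi>_def set_borel_measurable_def by simp
  have \<psi>0: "0 \<le> \<psi> x" for x using \<phi>(2) by (auto simp: \<psi>_def indicator_def)
  have g0: "0 \<le> indicator {0<..} x * g x" for x using g by (auto simp: indicator_def)
  have eq: "(indicator {0<..} x * g x) * \<psi> x = indicator {0<..} x *\<^sub>R (\<phi> x * g x)" for x
    by (auto simp: \<psi>_def indicator_def)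
  have "AE \<omega> in M. (\<lambda>n. (\<Sum>i=1..n. \<psi> (X i \<omega>)) / real n) \<longlonglongrightarrow> expectation (\<lambda>\<omega>. \<psi> (X 1 \<omega>))"
  proof (rule strong_law_of_large_numbers_nonneg)
    show "indep_vars (\<lambda>_. borel) (\<lambda>i \<omega>. \<psi> (X i \<omega>)) {1..}"
      by (rule indep_vars_compose2[OF indep]) measurable
    show "distr M borel (\<lambda>\<omega>. \<psi> (X i \<omega>)) = distr M borel (\<lambda>\<omega>. \<psi> (X 1 \<omega>))" if i: "i \<ge> 1" for i
    proof -
      have "distr M borel (\<lambda>\<omega>. \<psi> (X l \<omega>)) = distr (distr M lborel (X l)) borel \<psi>" if "l \<ge> 1" for l
        using dist[OF that] by (subst distr_distr) (auto simp: distributed_def comp_def)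
      then show ?thesis using dist[OF i] dist[of 1] i by (simp add: distributed_def)
    qed
    have "integrable lborel (\<lambda>x. (indicator {0<..} x * g x) * \<psi> x) = integrable M (\<lambda>\<omega>. \<psi> (X 1 \<omega>))"
      by (rule distributed_integrable[OF dist]) (auto simp: g0)
    then show "integrable M (\<lambda>\<omega>. \<psi> (X 1 \<omega>))" using int unfolding eq set_integrable_def by simp
  qed (rule \<psi>0)
  moreover have "AE \<omega> in M. \<forall>i\<in>{1..}. 0 < X i \<omega>"
    by (intro AE_ball_countable' AE_pos_of_density_on_pos[OF dist]) auto
  ultimately show ?thesis
  proof eventually_elim
    case (elim \<omega>)
    have "(\<Sum>i=1..n. \<psi> (X i \<omega>)) / real n = empirical_mean n (\<lambda>i. X i \<omega>) \<phi>" for n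
      unfolding empirical_mean_def \<psi>_def using elim(2)
      by (intro arg_cong2[where f="(/)"] sum.cong) auto
    moreover have "expectation (\<lambda>\<omega>. \<psi> (X 1 \<omega>)) = (LINT x:{0<..}|lborel. \<phi> x * g x)"
      unfolding set_lebesgue_integral_def eq[symmetric]
      by (rule distributed_integral[OF dist, symmetric]) (auto simp: g0)
    ultimately show ?case using elim(1) by simp
  qed
qed

end

text \<open>
  The probability-free core: along one sample for which countably many empirical means converge,
  the basic inequality, the a priori bound on the norm and the uniform one-sided law give
  convergence of the estimators in square mean.
\<close>

lemma lse_consistent_pointwise:
  fixes x :: "nat \<Rightarrow> real" and g0 :: "real \<Rightarrow> real"
  defines "w \<equiv> \<lambda>y::real. y powr (- 1 / 2)"
  assumes x: "\<And>i. i \<ge> 1 \<Longrightarrow> 0 < x i"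
    and lse: "\<And>n. n \<ge> 1 \<Longrightarrow> is_lse k n x (g n)"
    and g0_k: "g0 \<in> k_monotone k" and g0_L2: "g0 \<in> L2"
    and g0_int: "set_integrable lborel {0<..} g0"
    and wg0_int: "set_integrable lborel {0<..} (\<lambda>y. w y * g0 y)"
    and conv_w: "(\<lambda>n. empirical_mean n x w) \<longlonglongrightarrow> (LINT y:{0<..}|lborel. w y * g0 y)"
    and conv_g0: "(\<lambda>n. empirical_mean n x g0) \<longlonglongrightarrow> (LINT y:{0<..}|lborel. g0 y * g0 y)"
    and near0: "\<And>j::nat. (\<lambda>n. empirical_mean n x (\<lambda>y. w y * of_bool (y \<le> 1 / real (Suc j))))
        \<longlonglongrightarrow> (LINT y:{0<..}|lborel. of_bool (y \<le> 1 / real (Suc j)) * (w y * g0 y))"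
    and cells: "\<And>a b. a \<in> \<rat> \<Longrightarrow> b \<in> \<rat> \<Longrightarrow>
        (\<lambda>n. empirical_mean n x (\<lambda>y. of_bool (a < y \<and> y \<le> b)))
        \<longlonglongrightarrow> (LINT y:{0<..}|lborel. of_bool (a < y \<and> y \<le> b) * g0 y)"
  shows "(\<lambda>n. L2_norm (\<lambda>y. g n y - g0 y)) \<longlonglongrightarrow> 0"
proof -
  define J where "J = (LINT y:{0<..}|lborel. w y * g0 y)"
  have "0 \<le> J" unfolding J_def set_lebesgue_integral_def w_def
    by (intro Bochner_Integration.integral_nonneg) (auto simp: indicator_def k_monotone_nonneg[OF g0_k])
  then have K: "0 \<le> J + 1" by simp
  \<comment> \<open>the constant \<open>J + 1\<close> of the envelope for all late estimators\<close>
  have ev_norm: "\<forall>\<^sub>F n in sequentially. empirical_mean n x w < J + 1"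
    using conv_w by (rule order_tendstoD(2)) (simp add: J_def)
  have "(\<lambda>n. (L2_norm (\<lambda>y. g n y - g0 y))\<^sup>2) \<longlonglongrightarrow> 0"
  proof (rule order_tendstoI)
    fix a :: real assume "a < 0"
    then have "a < (L2_norm (\<lambda>y. g n y - g0 y))\<^sup>2" for n using zero_le_power2 less_le_trans by blast
    then show "\<forall>\<^sub>F n in sequentially. a < (L2_norm (\<lambda>y. g n y - g0 y))\<^sup>2" by simp
  next
    fix \<epsilon> :: real assume \<epsilon>: "0 < \<epsilon>"
    then have \<epsilon>2: "0 < \<epsilon> / 2" by simp
    have unif: "\<forall>\<^sub>F n in sequentially. \<forall>f. (\<forall>y>0. 0 \<le> f y) \<longrightarrow> antimono_on {0<..} f \<longrightarrow>
        (\<forall>y>0. f y \<le> (J + 1) * y powr (- 1 / 2)) \<longrightarrow> set_integrable lborel {0<..} (\<lambda>y. f y * g0 y) \<longrightarrow>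
        empirical_mean n x f \<le> (LINT y:{0<..}|lborel. f y * g0 y) + \<epsilon> / 2"
      by (rule empirical_mean_uniform_upper_bound[OF x k_monotone_nonneg[OF g0_k]
        k_monotone_antimono[OF g0_k] g0_int wg0_int[unfolded w_def] near0[unfolded w_def] cells K \<epsilon>2])
    have "\<forall>\<^sub>F n in sequentially. (LINT y:{0<..}|lborel. g0 y * g0 y) - \<epsilon> / 2 < empirical_mean n x g0"
      using conv_g0 by (rule order_tendstoD(1)) (use \<epsilon> in simp)
    from this unif ev_norm eventually_ge_at_top[of 1]
    show "\<forall>\<^sub>F n in sequentially. (L2_norm (\<lambda>y. g n y - g0 y))\<^sup>2 < \<epsilon>"
    proof eventually_elim
      case (elim n)
      note l = lse[OF elim(4)]
      note gk = lse_characterization(1)[OF l] and gL = lse_characterization(2)[OF l]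
      have "L2_norm (g n) \<le> empirical_mean n x w"
        unfolding w_def by (rule lse_L2_norm_le[OF l x])
      then have norm: "L2_norm (g n) \<le> J + 1" using elim by simp
      have "g n y \<le> (J + 1) * y powr (- 1 / 2)" if "0 < y" for y
      proof -
        have "g n y \<le> L2_norm (g n) * y powr (- 1 / 2)"
          by (rule decreasing_le_L2_norm[OF gL k_monotone_nonneg[OF gk] k_monotone_antimono[OF gk] that])
        also have "\<dots> \<le> (J + 1) * y powr (- 1 / 2)" using norm by (intro mult_right_mono) auto
        finally show ?thesis .
      qed
      then have "empirical_mean n x (g n) \<le> (LINT y:{0<..}|lborel. g n y * g0 y) + \<epsilon> / 2"
        using elim(2) k_monotone_nonneg[OF gk] k_monotone_antimono[OF gk] L2_mult_integrable[OF gL g0_L2]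
        by blast
      then show ?case
        using lse_error_le[OF l g0_k g0_L2] elim(1) by (simp add: power2_eq_square)
    qed
  qed
  from tendsto_real_sqrt[OF this] show ?thesis by (simp add: L2_norm_nonneg)
qed

theorem proposition3p3:
  fixes k :: nat and g0 :: "real \<Rightarrow> real" and M :: "'a measure"
    and X :: "nat \<Rightarrow> 'a \<Rightarrow> real" and gt :: "nat \<Rightarrow> 'a \<Rightarrow> real \<Rightarrow> real" and c :: real
  assumes "k \<ge> 2"
    and "g0 \<in> k_monotone k" and "density_on_pos g0"
    and "prob_space M"
    and "prob_space.indep_vars M (\<lambda>_. borel) X {1..}"
    and "\<And>i. i \<ge> 1 \<Longrightarrow> distributed M lborel (X i) (\<lambda>x. ennreal (indicator {0<..} x * g0 x))"
    and "\<And>n. n \<ge> 1 \<Longrightarrow> AE \<omega> in M. is_lse k n (\<lambda>i. X i \<omega>) (gt n \<omega>)"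
    and "c > 0"
    and "(\<integral>\<^sup>+x\<in>{0<..}. ennreal (x powr (- 1 / 2))
            \<partial>interval_measure (distribution_function g0)) < \<infinity>"
  shows "(AE \<omega> in M. (\<forall>n\<ge>1. (\<lambda>x. gt n \<omega> x - g0 x) \<in> L2) \<and>
            (\<lambda>n. L2_norm (\<lambda>x. gt n \<omega> x - g0 x)) \<longlonglongrightarrow> 0) \<and>
         (AE \<omega> in M. (\<lambda>n. SUP x\<in>{c..}. ennreal \<bar>gt n \<omega> x - g0 x\<bar>) \<longlonglongrightarrow> 0)"
proof -
  interpret prob_space M by fact
  note g0_k = assms(2) and indep = assms(5) and dist = assms(6) and c = assms(8)
  note g0_nonneg = k_monotone_nonneg[OF g0_k]
  define w where "w = (\<lambda>y::real. y powr (- 1 / 2))"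
  have w_nonneg: "0 \<le> w y" for y by (simp add: w_def)
  have [measurable]: "w \<in> borel_measurable borel" unfolding w_def by measurable
  have g0_int: "set_integrable lborel {0<..} g0" using assms(3) by (simp add: density_on_pos_def)
  have g0_meas [measurable]: "(\<lambda>x. indicator {0<..} x * g0 x) \<in> borel_measurable borel"
    using borel_measurable_integrable[OF g0_int[unfolded set_integrable_def]] by simp
  define D where "D = density lborel (\<lambda>x. ennreal (indicator {0<..} x * g0 x))"
  have "prob_space D"
  proof -
    have "prob_space (distr M lborel (X 1))"
      using dist[of 1] by (intro prob_space_distr) (simp add: distributed_def)
    then show ?thesis using dist[of 1] by (simp add: distributed_def D_def)
  qed
  then have "interval_measure (distribution_function g0) = D"
    unfolding D_def by (intro interval_measure_distribution_function assms(3))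
  then have "(\<integral>\<^sup>+x\<in>{0<..}. ennreal (w x) \<partial>D) < \<infinity>" using assms(9) by (simp add: w_def)
  also have "(\<integral>\<^sup>+x\<in>{0<..}. ennreal (w x) \<partial>D)
      = (\<integral>\<^sup>+x. ennreal (indicator {0<..} x * g0 x) * (ennreal (w x) * indicator {0<..} x) \<partial>lborel)"
    unfolding D_def by (subst nn_integral_density) auto
  also have "\<dots> = (\<integral>\<^sup>+x. ennreal (norm (w x * (indicator {0<..} x * g0 x))) \<partial>lborel)"
    by (intro nn_integral_cong)
      (auto simp: indicator_def g0_nonneg w_nonneg abs_mult ennreal_mult mult.commute)
  finally have "integrable lborel (\<lambda>x. w x * (indicator {0<..} x * g0 x))"
    by (intro integrableI_bounded) auto
  then have wg0_int: "set_integrable lborel {0<..} (\<lambda>x. w x * g0 x)"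
    unfolding set_integrable_def by (simp add: mult_ac)
  have g0_set_meas: "set_borel_measurable lborel {0<..} g0"
    unfolding set_borel_measurable_def using g0_meas by simp
  have g0_L2: "g0 \<in> L2"
    using wg0_int unfolding w_def
    by (intro decreasing_in_L2 g0_nonneg k_monotone_antimono[OF g0_k] g0_set_meas)
  note slln = AE_empirical_mean_tendsto[OF indep dist g0_nonneg]
  have set_meas: "set_borel_measurable lborel {0<..} \<phi>" if "\<phi> \<in> borel_measurable borel" for \<phi> :: "real \<Rightarrow> real"
    using that unfolding set_borel_measurable_def by measurable
  have ae_w: "AE \<omega> in M. (\<lambda>n. empirical_mean n (\<lambda>i. X i \<omega>) w)
      \<longlonglongrightarrow> (LINT y:{0<..}|lborel. w y * g0 y)"
    by (intro slln set_meas wg0_int w_nonneg) measurable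
  have ae_g0: "AE \<omega> in M. (\<lambda>n. empirical_mean n (\<lambda>i. X i \<omega>) g0)
      \<longlonglongrightarrow> (LINT y:{0<..}|lborel. g0 y * g0 y)"
    by (intro slln g0_set_meas g0_nonneg L2_mult_integrable g0_L2)
  have ae_near0: "AE \<omega> in M. \<forall>j::nat. (\<lambda>n. empirical_mean n (\<lambda>i. X i \<omega>) (\<lambda>y. w y * of_bool (y \<le> 1 / real (Suc j))))
      \<longlonglongrightarrow> (LINT y:{0<..}|lborel. of_bool (y \<le> 1 / real (Suc j)) * (w y * g0 y))"
    unfolding AE_all_countable
  proof
    fix j :: nat
    have "AE \<omega> in M. (\<lambda>n. empirical_mean n (\<lambda>i. X i \<omega>) (\<lambda>y. w y * of_bool (y \<le> 1 / real (Suc j))))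
        \<longlonglongrightarrow> (LINT y:{0<..}|lborel. w y * of_bool (y \<le> 1 / real (Suc j)) * g0 y)"
    proof (intro slln set_meas)
      show "set_integrable lborel {0<..} (\<lambda>y. w y * of_bool (y \<le> 1 / real (Suc j)) * g0 y)"
        using set_integrable_of_bool_mult[OF wg0_int, of "\<lambda>y. y \<le> 1 / real (Suc j)"]
        by (simp add: mult_ac)
    qed (auto simp: w_nonneg)
    then show "AE \<omega> in M. (\<lambda>n. empirical_mean n (\<lambda>i. X i \<omega>) (\<lambda>y. w y * of_bool (y \<le> 1 / real (Suc j))))
        \<longlonglongrightarrow> (LINT y:{0<..}|lborel. of_bool (y \<le> 1 / real (Suc j)) * (w y * g0 y))"
      by (simp add: mult_ac)
  qed
  have ae_cells: "AE \<omega> in M. \<forall>a\<in>\<rat>. \<forall>b\<in>\<rat>.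
      (\<lambda>n. empirical_mean n (\<lambda>i. X i \<omega>) (\<lambda>y. of_bool (a < y \<and> y \<le> b)))
      \<longlonglongrightarrow> (LINT y:{0<..}|lborel. of_bool (a < y \<and> y \<le> b) * g0 y)"
    by (intro AE_ball_countable' countable_rat slln set_meas set_integrable_of_bool_mult g0_int) auto
  have ae_pos: "AE \<omega> in M. \<forall>i\<in>{1..}. 0 < X i \<omega>"
    by (intro AE_ball_countable' AE_pos_of_density_on_pos[OF dist]) auto
  have ae_lse: "AE \<omega> in M. \<forall>n\<in>{1..}. is_lse k n (\<lambda>i. X i \<omega>) (gt n \<omega>)"
    by (intro AE_ball_countable' assms(7)) auto
  from ae_w ae_g0 ae_near0 ae_cells ae_pos ae_lse
  have L2_lim: "AE \<omega> in M. (\<lambda>n. L2_norm (\<lambda>x. gt n \<omega> x - g0 x)) \<longlonglongrightarrow> 0"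
  proof eventually_elim
    case (elim \<omega>)
    then show ?case
      using g0_k g0_L2 g0_int wg0_int unfolding w_def
      by (intro lse_consistent_pointwise[where x="\<lambda>i. X i \<omega>" and k=k]) auto
  qed
  have L2_mem: "AE \<omega> in M. \<forall>n\<ge>1. (\<lambda>x. gt n \<omega> x - g0 x) \<in> L2"
    using ae_lse by eventually_elim (auto intro!: L2_diff(1) g0_L2 intro: lse_characterization(2))
  have "AE \<omega> in M. (\<lambda>n. SUP x\<in>{c..}. ennreal \<bar>gt n \<omega> x - g0 x\<bar>) \<longlonglongrightarrow> 0"
    using L2_lim L2_mem ae_lse
  proof eventually_elim
    case (elim \<omega>)
    show ?case
    proof (rule order_tendstoI)
      fix e :: ennreal assume "0 < e"
      \<comment> \<open>\<open>e\<close> may be infinite, so a smaller value is needed to obtain a real tolerance\<close>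
      then obtain \<epsilon>' where \<epsilon>': "0 < \<epsilon>'" "\<epsilon>' < e" using dense by blast
      then have "\<epsilon>' < top" using less_le_trans[OF \<epsilon>'(2) top_greatest] by simp
      then obtain \<epsilon> where \<epsilon>: "\<epsilon>' = ennreal \<epsilon>" "0 < \<epsilon>"
        using \<epsilon>'(1) by (cases \<epsilon>') auto
      obtain \<rho> where \<rho>: "0 < \<rho>" "\<And>g x. antimono_on {0<..} g \<Longrightarrow> (\<lambda>y. g y - g0 y) \<in> L2 \<Longrightarrow>
          L2_norm (\<lambda>y. g y - g0 y) < \<rho> \<Longrightarrow> c \<le> x \<Longrightarrow> \<bar>g x - g0 x\<bar> \<le> \<epsilon>"
        using uniform_close_if_L2_close[OF k_monotone_convex[OF g0_k] g0_nonneg c \<epsilon>(2)] by blast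
      from order_tendstoD(2)[OF elim(1) \<rho>(1)] eventually_ge_at_top[of 1]
      show "\<forall>\<^sub>F n in sequentially. (SUP x\<in>{c..}. ennreal \<bar>gt n \<omega> x - g0 x\<bar>) < e"
      proof eventually_elim
        case n: (elim n)
        have "antimono_on {0<..} (gt n \<omega>)"
          using elim(3) n(2) by (auto intro!: k_monotone_antimono lse_characterization(1))
        then have "\<bar>gt n \<omega> x - g0 x\<bar> \<le> \<epsilon>" if "c \<le> x" for x
          using elim(2) n that by (intro \<rho>(2)) auto
        then have "(SUP x\<in>{c..}. ennreal \<bar>gt n \<omega> x - g0 x\<bar>) \<le> ennreal \<epsilon>"
          by (intro SUP_least ennreal_leI) auto
        then show ?case using \<epsilon> \<epsilon>' by simp
      qed
    qed simp
  qed
  then show ?thesis using L2_lim L2_mem by (auto simp: AE_conj_iff)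
qed

end
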